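(* Let $3\leq m\leq n$ be integers. Then the number $p_{m,n}$ of inequivalent integer $m$-gons with perimeter $n$ is \[ p_{m,n} = \sum_{d\mid \gcd(m,n)}\frac{\varphi(d)}{2n}\binom{n/d}{m/d} +\frac12 \left( \binom{\lfloor m/2\rfloor+\lfloor (n-m)/2\rfloor}{\lfloor m/2\rfloor} - \binom{\lfloor n/2\rfloor}{m-1} - \binom{\lfloor n/4\rfloor}{\lfloor m/2\rfloor} - \binom{\lfloor (n+2)/4\rfloor}{m/2} \right). \]
   Context: An integer $m$-gon is a polygon with $m$ sides whose side lengths are all positive integers; its perimeter is the sum of the side lengths. Reading the side lengths of an $m$-gon starting from any side, clockwise or anticlockwise, gives an $m$-tuple $(a_1,\dots,a_m)$; two $m$-gons are equivalent if the $m$-tuple of one can be obtained from that of the other by cyclically re-ordering and/or reversing the entries. (The side-length tuples of integer $m$-gons of perimeter $n$ are exactly the $m$-tuples of positive integers summing to $n$ with every entry less than $n/2$.) $\varphi$ is Euler's totient function, $\lfloor x\rfloor$ is the floor. Convention: a binomial coefficient $\binom{a}{b}$ has its usual meaning when $a,b$ are non-negative integers with $b\leq a$, and is $0$ otherwise (in particular it is $0$ when $b$ is not an integer, e.g. $\binom{x}{m/2}=0$ for odd $m$). *)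

theory Defs
  imports "HOL-Analysis.Analysis" "HOL-Number_Theory.Totient"
begin

text \<open>
  A polygon in the Euclidean plane (the type \<open>complex\<close>) is given by the cyclic list of
  its vertices; indices are read modulo the number of vertices.
\<close>

definition vertex :: "complex list \<Rightarrow> nat \<Rightarrow> complex" where
  "vertex P i = P ! (i mod length P)"

definition side :: "complex list \<Rightarrow> nat \<Rightarrow> complex set" where
  "side P i = closed_segment (vertex P i) (vertex P (i + 1))"

text \<open>
  Polygons are simple (distinct sides meet only in common end points) and
  have genuine corners, so that the number of sides is well defined; convexity is not required.
\<close>

definition is_polygon :: "nat \<Rightarrow> complex list \<Rightarrow> bool" where
  "is_polygon m P \<longleftrightarrow>
     3 \<le> m \<and> length P = m \<and> distinct P \<and>
     (\<forall>i<m. \<forall>j<m. i \<noteq> j \<longrightarrow>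
        side P i \<inter> side P j =
          {vertex P i, vertex P (i + 1)} \<inter> {vertex P j, vertex P (j + 1)}) \<and>
     (\<forall>i<m. \<not> collinear {vertex P i, vertex P (i + 1), vertex P (i + 2)})"

definition side_lengths :: "complex list \<Rightarrow> real list" where
  "side_lengths P = map (\<lambda>i. dist (vertex P i) (vertex P (i + 1))) [0..<length P]"

definition perimeter :: "complex list \<Rightarrow> real" where
  "perimeter P = sum_list (side_lengths P)"

definition integer_polygons :: "nat \<Rightarrow> nat \<Rightarrow> complex list set" where
  "integer_polygons m n =
     {P. is_polygon m P \<and> (\<forall>a\<in>set (side_lengths P). a \<in> \<int> \<and> 0 < a) \<and> perimeter P = real n}"

definition dihedral_eq :: "'a list \<Rightarrow> 'a list \<Rightarrow> bool" where
  "dihedral_eq xs ys \<longleftrightarrow> (\<exists>k. ys = rotate k xs \<or> ys = rotate k (rev xs))"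

definition polygon_equiv :: "nat \<Rightarrow> nat \<Rightarrow> (complex list \<times> complex list) set" where
  "polygon_equiv m n =
     {(P, Q). P \<in> integer_polygons m n \<and> Q \<in> integer_polygons m n \<and>
              dihedral_eq (side_lengths P) (side_lengths Q)}"

text \<open>
  There are infinitely many polygons, but only finitely many classes: a class is
  determined by a tuple of positive integers with sum \<open>n\<close>.
\<close>

definition num_polygons :: "nat \<Rightarrow> nat \<Rightarrow> nat" where
  "num_polygons m n = card (integer_polygons m n // polygon_equiv m n)"

end

theory Submission imports Defs begin

text \<open>
  The side-length tuples of integer \<open>m\<close>-gons of perimeter \<open>n\<close> are exactly the compositions of \<open>n\<close>
  into \<open>m\<close> parts smaller than \<open>n/2\<close>: necessity is the strict triangle inequality, and every such
  tuple is realised by a polygon inscribed in a circle, whose radius is found by the intermediate value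
  theorem. Burnside's lemma for the dihedral group of order \<open>2m\<close> then counts the classes. A
  rotation of order \<open>d > 1\<close> fixes the \<open>d\<close>-fold repetitions of the compositions of \<open>n/d\<close> into \<open>m/d\<close>
  parts, for which the bound on the parts is automatic; for the identity, the compositions with a
  (necessarily unique) part of size at least \<open>n/2\<close> have to be removed. Up to
  conjugation there is one reflection for odd \<open>m\<close> and there are two for even \<open>m\<close>; the tuples they
  fix are counted through lists of positive integers with bounded sum.
\<close>

subsection \<open>Strictly convex polygons are simple\<close>

text \<open>Twice the signed area of the triangle \<open>a b c\<close>: positive when the three
  points make a left turn, zero when they lie on a line.\<close>

definition orient :: "complex \<Rightarrow> complex \<Rightarrow> complex \<Rightarrow> real" where
  "orient a b c = Re (b - a) * Im (c - a) - Im (b - a) * Re (c - a)"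

lemma orient_affine:
  "orient a b ((1 - u) *\<^sub>R c + u *\<^sub>R d) = (1 - u) * orient a b c + u * orient a b d"
  by (simp add: orient_def algebra_simps)

lemma orient_degenerate [simp]: "orient a a c = 0" "orient a b a = 0" "orient a b b = 0"
  by (simp_all add: orient_def)

lemma collinear_imp_orient_eq_0:
  assumes "collinear {a, b, c}"
  shows "orient a b c = 0"
proof -
  from assms consider "a = c" | u where "b = u *\<^sub>R a + (1 - u) *\<^sub>R c"
    by (auto simp: collinear_3_expand)
  then show ?thesis
  proof cases
    case 2
    show ?thesis unfolding 2 orient_def by (simp add: algebra_simps)
  qed simp
qed

lemma Suc_mod_eq_iff:
  assumes "i < m" "j < m"
  shows "Suc i mod m = Suc j mod m \<longleftrightarrow> i = j"
  using assms by (auto simp: mod_Suc)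

text \<open>Every vertex off a side lies strictly to the left of its line. Along any other side,
  \<open>orient\<close> is therefore a nonnegative affine function that vanishes only at an end
  point shared with the first side. Corners are genuine because three consecutive vertices have
  positive orientation.\<close>

lemma convex_imp_is_polygon:
  assumes m: "3 \<le> m" "length P = m"
    and convex: "\<And>i k. i < m \<Longrightarrow> k < m \<Longrightarrow> k \<noteq> i \<Longrightarrow> k \<noteq> Suc i mod m \<Longrightarrow>
      0 < orient (P ! i) (P ! (Suc i mod m)) (P ! k)"
  shows "is_polygon m P"
proof -
  have neq: "Suc i mod m \<noteq> i" "Suc (Suc i) mod m \<noteq> i" "Suc (Suc i) mod m \<noteq> Suc i mod m"
    if "i < m" for i
    using that m by (auto simp: mod_Suc)
  have lt: "j mod m < m" for j using m by simp
  have next_pos: "0 < orient (P ! i) (P ! (Suc i mod m)) (P ! (Suc (Suc i) mod m))" if "i < m" for i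
    using convex[OF that lt[of "Suc (Suc i)"]] neq[OF that] by simp
  have dist: "distinct P"
  proof (unfold distinct_conv_nth, intro allI impI notI)
    fix i k assume ik: "i < length P" "k < length P" "i \<noteq> k" "P ! i = P ! k"
    show False
    \<comment> \<open>Coinciding vertices would make a positive orientation degenerate: that of
      three consecutive vertices from \<open>i\<close> on if \<open>k\<close> is the next vertex,
      that of side \<open>i\<close> and vertex \<open>k\<close> otherwise.\<close>
    proof (cases "k = Suc i mod m")
      case True
      then show False using next_pos[of i] ik m by simp
    next
      case False
      then show False using convex[of i k] ik m by simp
    qed
  qed
  have sides: "side P i \<inter> side P j = {vertex P i, vertex P (i + 1)} \<inter> {vertex P j, vertex P (j + 1)}"
    if ij: "i < m" "j < m" "i \<noteq> j" for i j
  proof (intro equalityI subsetI)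
    fix x assume x: "x \<in> side P i \<inter> side P j"
    let ?o = "orient (P ! i) (P ! (Suc i mod m))"
    obtain u where u: "0 \<le> u" "u \<le> 1" "x = (1 - u) *\<^sub>R P ! j + u *\<^sub>R P ! (Suc j mod m)"
      using x ij m by (auto simp: side_def vertex_def closed_segment_def)
    obtain v where "x = (1 - v) *\<^sub>R P ! i + v *\<^sub>R P ! (Suc i mod m)"
      using x ij m by (auto simp: side_def vertex_def closed_segment_def)
    then have "?o x = 0" by (simp only: orient_affine) simp
    \<comment> \<open>The point lies on the line through side \<open>i\<close>, so this convex
      combination of nonnegative values is zero; a term with positive weight must have value
      zero.\<close>
    then have sum0: "(1 - u) * ?o (P ! j) + u * ?o (P ! (Suc j mod m)) = 0"
      using u by (simp only: orient_affine)
    have nn: "0 \<le> ?o (P ! k)" if "k < m" for k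
      using convex[of i k] ij that by (cases "k = i \<or> k = Suc i mod m") force+
    have "(1 - u) * ?o (P ! j) = 0" "u * ?o (P ! (Suc j mod m)) = 0"
      using sum0 nn[of j] nn[OF lt[of "Suc j"]] u ij
      by (smt (verit) mult_nonneg_nonneg)+
    then have A: "u = 1 \<or> ?o (P ! j) = 0" and B: "u = 0 \<or> ?o (P ! (Suc j mod m)) = 0" by auto
    have jA: "j = Suc i mod m" if "?o (P ! j) = 0"
      using convex[of i j] ij that by force
    have jB: "Suc j mod m = i" if "?o (P ! (Suc j mod m)) = 0"
      using convex[OF ij(1) lt[of "Suc j"]] ij that Suc_mod_eq_iff[of i m j] by force
    \<comment> \<open>As \<open>m\<close> is at least 3, the two end points of side \<open>j\<close>
      cannot both belong to side \<open>i\<close>, so \<open>u\<close> is forced to one end of its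
      range.\<close>
    have "u = 1 \<and> Suc j mod m = i \<or> u = 0 \<and> j = Suc i mod m"
    proof (cases "u = 1")
      case True
      then show ?thesis using B jB by auto
    next
      case False
      then have j: "j = Suc i mod m" using A jA by auto
      then have "Suc j mod m \<noteq> i" using neq(2)[OF ij(1)] by (simp add: mod_Suc_eq)
      then show ?thesis using B jB j by auto
    qed
    then show "x \<in> {vertex P i, vertex P (i + 1)} \<inter> {vertex P j, vertex P (j + 1)}"
      using u ij m by (auto simp: vertex_def)
  next
    fix x assume "x \<in> {vertex P i, vertex P (i + 1)} \<inter> {vertex P j, vertex P (j + 1)}"
    then show "x \<in> side P i \<inter> side P j" by (auto simp: side_def)
  qed
  have "\<not> collinear {vertex P i, vertex P (i + 1), vertex P (i + 2)}" if "i < m" for i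
    using next_pos[OF that] that m
      collinear_imp_orient_eq_0[of "vertex P i" "vertex P (i + 1)" "vertex P (i + 2)"]
    by (auto simp: vertex_def)
  with sides dist m show ?thesis by (auto simp: is_polygon_def)
qed

subsection \<open>Inscribed polygons\<close>

text \<open>The angles of an inscribed triangle are half its central angles, and its area is twice
  the squared radius times the product of their sines. With signs kept, the order of the angular
  parameters decides the orientation.\<close>

lemma orient_cis:
  "orient (of_real r * cis a) (of_real r * cis b) (of_real r * cis c) =
     4 * r\<^sup>2 * sin ((b - a) / 2) * sin ((c - b) / 2) * sin ((c - a) / 2)"
proof -
  define x y where "x = (b - a) / 2" and "y = (c - b) / 2"
  have *: "b - a = 2 * x" "c - b = 2 * y" "c - a = 2 * x + 2 * y" "(c - a) / 2 = x + y"
    by (simp_all add: x_def y_def field_simps)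
  have "orient (of_real r * cis a) (of_real r * cis b) (of_real r * cis c) =
    r\<^sup>2 * (sin (b - a) + sin (c - b) - sin (c - a))"
    by (simp add: orient_def sin_diff algebra_simps power2_eq_square)
  also have "sin (b - a) + sin (c - b) - sin (c - a) =
      sin (2 * x) * (1 - cos (2 * y)) + sin (2 * y) * (1 - cos (2 * x))"
    by (simp add: * sin_add algebra_simps)
  also have "\<dots> = 4 * sin x * sin y * sin (x + y)"
    by (simp only: sin_double cos_double_sin sin_add power2_eq_square) (simp add: algebra_simps)
  finally show ?thesis by (simp add: x_def[symmetric] y_def[symmetric] *(4))
qed

text \<open>This is the chord formula for the central angle \<open>2 * x\<close>; \<open>x\<close>
  is an inscribed angle over the chord.\<close>

lemma dist_cis:
  assumes "r \<ge> 0" "0 \<le> x" "x \<le> pi"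
  shows "dist (of_real r * cis a) (of_real r * cis (a + 2 * x)) = 2 * r * sin x"
proof -
  have "dist (of_real r * cis a) (of_real r * cis (a + 2 * x)) =
    norm (of_real r * cis a * (1 - cis (2 * x)))"
    by (simp add: dist_norm right_diff_distrib mult.assoc cis_mult)
  also have "\<dots> = r * norm (1 - cis (2 * x))" using assms by (simp add: norm_mult)
  also have "norm (1 - cis (2 * x)) = sqrt ((1 - cos (2 * x))\<^sup>2 + (sin (2 * x))\<^sup>2)"
    by (simp add: cmod_def)
  also have "(1 - cos (2 * x))\<^sup>2 + (sin (2 * x))\<^sup>2 = (2 * sin x)\<^sup>2"
  proof -
    have "(sin x)\<^sup>2 * (cos x)\<^sup>2 = (sin x)\<^sup>2 - (sin x)\<^sup>2 * (sin x)\<^sup>2"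
      by (simp add: cos_squared_eq algebra_simps)
    then show ?thesis
      by (simp only: sin_double cos_double_sin power2_eq_square) (simp add: algebra_simps)
  qed
  also have "sqrt ((2 * sin x)\<^sup>2) = 2 * sin x"
    using assms by (intro real_sqrt_unique) (auto simp: sin_ge_zero)
  finally show ?thesis by simp
qed

text \<open>
  If the circumcentre lies outside the polygon, the longest side subtends the obtuse inscribed angle
  \<open>pi - arcsin\<close>; this is the second case below.
\<close>

lemma inscribed_angles_exist:
  fixes a :: "nat \<Rightarrow> real"
  assumes m: "m > 0" and pos: "\<And>i. i < m \<Longrightarrow> 0 < a i"
    and ineq: "\<And>i. i < m \<Longrightarrow> 2 * a i < (\<Sum>j<m. a j)"
  shows "\<exists>r \<alpha>. 0 < r \<and> (\<forall>i<m. 0 < \<alpha> i \<and> \<alpha> i < pi \<and> a i = 2 * r * sin (\<alpha> i)) \<and> (\<Sum>i<m. \<alpha> i) = pi"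
proof -
  \<comment> \<open>The parameter \<open>t\<close> below is the reciprocal of the diameter of the
    circle. It ranges up to \<open>1 / A\<close>, where the longest side is itself a
    diameter.\<close>
  define A where "A = Max (a ` {..<m})"
  have le_A: "a i \<le> A" if "i < m" for i using that by (simp add: A_def)
  have "A \<in> a ` {..<m}" unfolding A_def using m by (intro Max_in) auto
  then obtain M where M: "M < m" "a M = A" by auto
  have A0: "0 < A" using pos M by metis
  have range: "0 \<le> a i * t" "a i * t \<le> 1" if "i < m" "t \<in> {0..1 / A}" for i t
  proof -
    show "0 \<le> a i * t" using pos that by (simp add: less_imp_le)
    have "a i * t \<le> A * (1 / A)" using that le_A pos[of i] A0 by (intro mult_mono) auto
    then show "a i * t \<le> 1" using A0 by simp
  qed
  have cont: "continuous_on {0..1 / A} (\<lambda>t. arcsin (a i * t))" if "i < m" for i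
    using range[OF that] by (intro continuous_intros) (force intro: order_trans[of _ 0])+
  have angle: "0 < arcsin (a i * t)" "arcsin (a i * t) \<le> pi / 2" "sin (arcsin (a i * t)) = a i * t"
    if "i < m" "0 < t" "t \<le> 1 / A" for i t
  proof -
    have r: "0 < a i * t" "a i * t \<le> 1" using range[of i t] pos[of i] that by auto
    show "0 < arcsin (a i * t)" using r arcsin_less_arcsin[of 0 "a i * t"] by simp
    show "arcsin (a i * t) \<le> pi / 2" using r by (intro arcsin_ubound) auto
    show "sin (arcsin (a i * t)) = a i * t" using r by simp
  qed
  show ?thesis
  proof (cases "(\<Sum>i<m. arcsin (a i * (1 / A))) \<ge> pi")
    case True
    \<comment> \<open>The sum of the angles is 0 at \<open>t = 0\<close> and at least
      \<open>pi\<close> at \<open>1 / A\<close>.\<close>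
    have "\<exists>t\<ge>0. t \<le> 1 / A \<and> (\<Sum>i<m. arcsin (a i * t)) = pi"
      using True A0 cont by (intro IVT') (auto intro!: continuous_on_sum)
    then obtain t where t: "0 \<le> t" "t \<le> 1 / A" "(\<Sum>i<m. arcsin (a i * t)) = pi" by auto
    have t0: "0 < t" using t by (cases "t = 0") auto
    have "0 < arcsin (a i * t) \<and> arcsin (a i * t) < pi \<and> a i = 2 * (1 / (2 * t)) * sin (arcsin (a i * t))"
      if "i < m" for i
    proof -
      have "arcsin (a i * t) < pi" using angle(2)[OF that t0 t(2)] pi_gt_zero by linarith
      then show ?thesis using angle[OF that t0 t(2)] t0 by simp
    qed
    then show ?thesis using t t0 by (intro exI[of _ "1 / (2 * t)"] exI[of _ "\<lambda>i. arcsin (a i * t)"]) auto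
  next
    case False
    let ?I = "{..<m} - {M}"
    \<comment> \<open>At a zero of \<open>h\<close> the angles of the other sides add up to
      \<open>arcsin (a M * t)\<close>; taking the supplement for side \<open>M\<close> makes the
      total \<open>pi\<close>.\<close>
    define h where "h t = (\<Sum>i\<in>?I. arcsin (a i * t)) - arcsin (a M * t)" for t
    have hend: "h (1 / A) < 0"
    proof -
      have "(\<Sum>i<m. arcsin (a i * (1 / A))) = (\<Sum>i\<in>?I. arcsin (a i * (1 / A))) + pi / 2"
        using M A0 by (subst sum.remove[of _ M]) auto
      then show ?thesis using False M A0 by (simp add: h_def)
    qed
    have conth: "continuous_on {0..1 / A} h"
      unfolding h_def using cont M by (intro continuous_on_diff continuous_on_sum) auto
    \<comment> \<open>\<open>h\<close> vanishes at 0, which gives no circle. Its derivative there is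
      positive by the polygon inequality, so \<open>h\<close> is positive shortly after 0; being
      negative at \<open>1 / A\<close>, it has another zero in between.\<close>
    have deriv: "(h has_real_derivative (\<Sum>i\<in>?I. a i) - a M) (at 0)"
      unfolding h_def by (auto intro!: derivative_eq_intros)
    moreover have "0 < (\<Sum>i\<in>?I. a i) - a M"
      using ineq[OF M(1)] M sum.remove[of "{..<m}" M a] by simp
    ultimately obtain d where d: "0 < d" "\<And>s. 0 < s \<Longrightarrow> s < d \<Longrightarrow> h 0 < h (0 + s)"
      using DERIV_pos_inc_right by metis
    define s where "s = min (d / 2) (1 / A)"
    have s: "0 < s" "s \<le> 1 / A" "s < d" using d A0 by (auto simp: s_def min_def)
    have "0 < h s" using d(2)[of s] s by (simp add: h_def)
    then have "\<exists>t\<ge>s. t \<le> 1 / A \<and> h t = 0"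
      using s hend conth by (intro IVT2') (auto intro: continuous_on_subset)
    then obtain t where t: "s \<le> t" "t \<le> 1 / A" "h t = 0" by auto
    have t0: "0 < t" using t s by simp
    define \<alpha> where "\<alpha> i = (if i = M then pi - arcsin (a i * t) else arcsin (a i * t))" for i
    have "0 < \<alpha> i \<and> \<alpha> i < pi \<and> a i = 2 * (1 / (2 * t)) * sin (\<alpha> i)" if "i < m" for i
    proof -
      have "arcsin (a i * t) < pi" using angle(2)[OF that t0 t(2)] pi_gt_zero by linarith
      then show ?thesis using angle[OF that t0 t(2)] t0 by (cases "i = M") (simp_all add: \<alpha>_def)
    qed
    moreover have "(\<Sum>i<m. \<alpha> i) = pi"
    proof -
      have "(\<Sum>i<m. \<alpha> i) = \<alpha> M + (\<Sum>i\<in>?I. \<alpha> i)" using M by (intro sum.remove) auto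
      also have "(\<Sum>i\<in>?I. \<alpha> i) = (\<Sum>i\<in>?I. arcsin (a i * t))"
        by (intro sum.cong) (auto simp: \<alpha>_def)
      finally show ?thesis using t by (simp add: h_def \<alpha>_def)
    qed
    ultimately show ?thesis using t0 by (intro exI[of _ "1 / (2 * t)"] exI[of _ \<alpha>]) auto
  qed
qed

lemma side_lengths_nth: "i < length P \<Longrightarrow> side_lengths P ! i = dist (vertex P i) (vertex P (i + 1))"
  by (simp add: side_lengths_def)

lemma length_side_lengths [simp]: "length (side_lengths P) = length P"
  by (simp add: side_lengths_def)

lemma polygon_with_side_lengths_exists:
  fixes as :: "real list"
  assumes m: "length as = m" "3 \<le> m" and pos: "\<And>a. a \<in> set as \<Longrightarrow> 0 < a"
    and ineq: "\<And>a. a \<in> set as \<Longrightarrow> 2 * a < sum_list as"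
  shows "\<exists>P. is_polygon m P \<and> side_lengths P = as"
proof -
  have sum: "sum_list as = (\<Sum>j<m. as ! j)"
    using m by (simp add: sum_list_sum_nth atLeast0LessThan)
  have "\<exists>r \<alpha>. 0 < r \<and> (\<forall>i<m. 0 < \<alpha> i \<and> \<alpha> i < pi \<and> as ! i = 2 * r * sin (\<alpha> i)) \<and> (\<Sum>i<m. \<alpha> i) = pi"
    using m pos ineq by (intro inscribed_angles_exist) (auto simp: sum[symmetric])
  then obtain r \<alpha> where r: "0 < r" and \<alpha>: "\<And>i. i < m \<Longrightarrow> 0 < \<alpha> i" "\<And>i. i < m \<Longrightarrow> \<alpha> i < pi"
    "\<And>i. i < m \<Longrightarrow> as ! i = 2 * r * sin (\<alpha> i)" and sum\<alpha>: "(\<Sum>i<m. \<alpha> i) = pi"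
    by auto
  \<comment> \<open>Central angles are twice the inscribed ones, so the vertices go round the circle
    exactly once.\<close>
  define \<phi> where "\<phi> k = 2 * (\<Sum>i<k. \<alpha> i)" for k
  define V where "V k = of_real r * cis (\<phi> k)" for k
  define P where "P = map V [0..<m]"
  have \<phi>_mono: "\<phi> i < \<phi> j" if "i < j" "j \<le> m" for i j
  proof -
    have "(\<Sum>l<i. \<alpha> l) < (\<Sum>l<j. \<alpha> l)"
      using that \<alpha>(1) by (intro sum_strict_mono2[of _ _ i]) (auto simp: less_imp_le)
    then show ?thesis by (simp add: \<phi>_def)
  qed
  have \<phi>0: "\<phi> 0 = 0" "\<phi> m = 2 * pi" by (simp_all add: \<phi>_def sum\<alpha>)
  have \<phi>_range: "0 \<le> \<phi> i" if "i \<le> m" for i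
    using \<phi>_mono[of 0 i] \<phi>0 that by (cases "i = 0") auto
  have P_nth: "P ! i = V i" if "i < m" for i using that by (simp add: P_def)
  have P_Suc: "P ! (Suc i mod m) = V (Suc i)" if "i < m" for i
  proof (cases "Suc i = m")
    case True
    then show ?thesis using m \<phi>0 P_nth[of 0] by (auto simp: V_def)
  next
    case False
    then show ?thesis using that by (simp add: P_nth)
  qed
  have lenP: "length P = m" by (simp add: P_def)
  \<comment> \<open>The excluded pair \<open>0\<close>, \<open>m\<close> is a full turn, for which
    the half difference is \<open>pi\<close> and the sine vanishes.\<close>
  have sin_pos: "0 < sin ((\<phi> j - \<phi> i) / 2)" if "i < j" "j \<le> m" "i \<noteq> 0 \<or> j \<noteq> m" for i j
  proof (rule sin_gt_zero)
    show "0 < (\<phi> j - \<phi> i) / 2" using \<phi>_mono that by simp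
    have "\<phi> j < 2 * pi \<or> 0 < \<phi> i"
      using \<phi>_mono[of j m] \<phi>_mono[of 0 i] \<phi>0 that by auto
    moreover have "\<phi> j \<le> 2 * pi" "0 \<le> \<phi> i"
      using \<phi>_mono[of j m] \<phi>0 \<phi>_range[of i] that by (cases "j = m"; auto)+
    ultimately show "(\<phi> j - \<phi> i) / 2 < pi" by auto
  qed
  have "is_polygon m P"
  proof (rule convex_imp_is_polygon[OF m(2) lenP])
    fix i k assume ik: "i < m" "k < m" "k \<noteq> i" "k \<noteq> Suc i mod m"
    have *: "orient (P ! i) (P ! (Suc i mod m)) (P ! k) = 4 * r\<^sup>2 * sin ((\<phi> (Suc i) - \<phi> i) / 2) *
      (sin ((\<phi> k - \<phi> (Suc i)) / 2) * sin ((\<phi> k - \<phi> i) / 2))"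
      unfolding P_nth[OF ik(1)] P_nth[OF ik(2)] P_Suc[OF ik(1)] V_def orient_cis by simp
    have 1: "0 < sin ((\<phi> (Suc i) - \<phi> i) / 2)" using ik m by (intro sin_pos) auto
    have 2: "0 < sin ((\<phi> k - \<phi> (Suc i)) / 2) * sin ((\<phi> k - \<phi> i) / 2)"
    \<comment> \<open>For \<open>k < i\<close> both sines are negative; for \<open>k\<close> beyond
      \<open>Suc i\<close> both are positive.\<close>
    proof (cases "k < i")
      case True
      have "0 < sin ((\<phi> (Suc i) - \<phi> k) / 2)" "0 < sin ((\<phi> i - \<phi> k) / 2)"
        using True ik by (intro sin_pos; auto)+
      moreover have "sin ((\<phi> k - \<phi> j) / 2) = - sin ((\<phi> j - \<phi> k) / 2)" for j
        by (simp add: diff_divide_distrib flip: sin_minus)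
      ultimately show ?thesis by simp
    next
      case False
      then have "Suc i < k" using ik by (cases "Suc i = k") auto
      then show ?thesis using ik by (intro mult_pos_pos sin_pos) auto
    qed
    show "0 < orient (P ! i) (P ! (Suc i mod m)) (P ! k)"
      unfolding * using 1 2 r by (intro mult_pos_pos[OF mult_pos_pos 2]) auto
  qed
  moreover have "side_lengths P = as"
  proof (rule nth_equalityI)
    fix i assume "i < length (side_lengths P)"
    then have i: "i < m" using lenP by simp
    then have "side_lengths P ! i = dist (V i) (V (Suc i))"
      using lenP P_nth[OF i] P_Suc[OF i] by (simp add: side_lengths_nth vertex_def)
    also have "V (Suc i) = of_real r * cis (\<phi> i + 2 * \<alpha> i)" by (simp add: V_def \<phi>_def)
    also have "dist (V i) (of_real r * cis (\<phi> i + 2 * \<alpha> i)) = 2 * r * sin (\<alpha> i)"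
      unfolding V_def using r \<alpha>(1,2)[OF i] by (intro dist_cis) auto
    finally show "side_lengths P ! i = as ! i" using \<alpha>(3)[OF i] by simp
  qed (simp add: lenP m)
  ultimately show ?thesis by blast
qed

subsection \<open>Polygon inequality\<close>

lemma dist_le_sum_path:
  "a \<le> b \<Longrightarrow> dist (w a) (w b) \<le> (\<Sum>j\<in>{a..<b}. dist (w j) (w (Suc j)))"
proof (induction b rule: dec_induct)
  case (step b)
  then show ?case using dist_triangle[of "w a" "w (Suc b)" "w b"] by simp
qed simp

lemma sum_periodic_shift:
  fixes f :: "nat \<Rightarrow> real"
  assumes "\<And>i. f (i + m) = f i"
  shows "(\<Sum>j<m. f (i + j)) = (\<Sum>j<m. f j)"
proof (induction i)
  case (Suc i)
  have "f i + (\<Sum>j<m. f (Suc i + j)) = (\<Sum>j<Suc m. f (i + j))"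
    by (simp only: sum.lessThan_Suc_shift) simp
  also have "\<dots> = (\<Sum>j<m. f j) + f i" using Suc assms by simp
  finally show ?case by simp
qed simp

text \<open>The remaining sides form a path joining the end points of the chosen side. As
  \<open>m\<close> is at least 3, this path has an interior corner, which is not straight, so the
  triangle inequality is strict there.\<close>

lemma polygon_inequality:
  assumes P: "is_polygon m P" and a: "a \<in> set (side_lengths P)"
  shows "2 * a < perimeter P"
proof -
  have m: "3 \<le> m" "length P = m" using P by (auto simp: is_polygon_def)
  define f where "f i = dist (vertex P i) (vertex P (Suc i))" for i
  have per: "vertex P (i + m) = vertex P i" for i using m by (simp add: vertex_def)
  then have fper: "f (i + m) = f i" for i by (metis add_Suc f_def)
  obtain i where i: "i < m" "a = f i"
    using a m by (auto simp: side_lengths_def f_def)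
  have perim: "perimeter P = (\<Sum>j<m. f j)"
    unfolding perimeter_def side_lengths_def
    by (simp add: m f_def interv_sum_list_conv_sum_set_nat atLeast0LessThan)
  \<comment> \<open>\<open>w\<close> starts at the second end point of side \<open>i\<close>; its
    first \<open>m\<close> values run through all vertices and finish at the first end
    point.\<close>
  define w where "w j = vertex P (Suc i + j)" for j
  have "\<not> collinear {w 0, w 1, w 2}"
  proof -
    have "Suc i mod m < m" using m by simp
    then have "\<not> collinear {vertex P (Suc i mod m), vertex P (Suc i mod m + 1), vertex P (Suc i mod m + 2)}"
      using P unfolding is_polygon_def by blast
    moreover have "vertex P (Suc i mod m + c) = vertex P (Suc i + c)" for c
      using m by (simp add: vertex_def mod_add_left_eq)
    from this[of 0] this[of 1] this[of 2] calculation show ?thesis by (simp add: w_def)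
  qed
  \<comment> \<open>Equality in the triangle inequality would put \<open>w 1\<close> between
    \<open>w 0\<close> and \<open>w 2\<close>.\<close>
  then have "dist (w 0) (w 2) < dist (w 0) (w 1) + dist (w 1) (w 2)"
    using dist_triangle[of "w 0" "w 2" "w 1"] between[of "w 0" "w 2" "w 1"]
      between_imp_collinear[of "w 0" "w 2" "w 1"] by (force simp: insert_commute)
  moreover have "dist (w 2) (w (m - 1)) \<le> (\<Sum>j\<in>{2..<m - 1}. dist (w j) (w (Suc j)))"
    using m by (intro dist_le_sum_path) auto
  moreover have "dist (w 0) (w (m - 1)) \<le> dist (w 0) (w 2) + dist (w 2) (w (m - 1))"
    by (rule dist_triangle)
  moreover have "(\<Sum>j<m - 1. dist (w j) (w (Suc j))) =
    dist (w 0) (w 1) + dist (w 1) (w 2) + (\<Sum>j\<in>{2..<m - 1}. dist (w j) (w (Suc j)))"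
  proof -
    have "{..<m - 1} = {0, 1} \<union> {2..<m - 1}" using m by auto
    then show ?thesis by (simp add: sum.union_disjoint numeral_2_eq_2)
  qed
  moreover have "dist (w 0) (w (m - 1)) = f i"
  proof -
    have "w (m - 1) = vertex P (i + m)" using m by (simp add: w_def)
    then show ?thesis using per by (simp add: w_def f_def dist_commute)
  qed
  moreover have "perimeter P = (\<Sum>j<m - 1. dist (w j) (w (Suc j))) + f i"
  proof -
    have "perimeter P = (\<Sum>j<m. f (Suc i + j))"
      using sum_periodic_shift[of f m "Suc i"] fper perim by simp
    also have "\<dots> = (\<Sum>j<Suc (m - 1). f (Suc i + j))" using m by simp
    also have "\<dots> = (\<Sum>j<m - 1. f (Suc i + j)) + f (Suc i + (m - 1))" by simp
    also have "f (Suc i + (m - 1)) = f (i + m)" using m by simp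
    finally show ?thesis using fper by (simp add: f_def w_def)
  qed
  ultimately show ?thesis using i by linarith
qed

subsection \<open>Counting orbits\<close>

text \<open>The group laws are imposed through their effect on \<open>X\<close>, since the dihedral
  multiplication used below matches the action on lists of one fixed length.\<close>

lemma equiv_orbit_relation:
  assumes mul: "\<And>g h. g \<in> G \<Longrightarrow> h \<in> G \<Longrightarrow> mul g h \<in> G"
    and act_mul: "\<And>g h x. g \<in> G \<Longrightarrow> h \<in> G \<Longrightarrow> x \<in> X \<Longrightarrow> act (mul g h) x = act g (act h x)"
    and unit: "e \<in> G" "\<And>x. x \<in> X \<Longrightarrow> act e x = x"
    and inv: "\<And>g. g \<in> G \<Longrightarrow> \<exists>h\<in>G. \<forall>x\<in>X. act h (act g x) = x"
  shows "equiv X {(x, y). x \<in> X \<and> y \<in> X \<and> (\<exists>g\<in>G. y = act g x)}"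
proof (rule equivI)
  show "refl_on X {(x, y). x \<in> X \<and> y \<in> X \<and> (\<exists>g\<in>G. y = act g x)}"
    using unit by (auto intro!: refl_onI bexI[of _ e])
  show "sym {(x, y). x \<in> X \<and> y \<in> X \<and> (\<exists>g\<in>G. y = act g x)}"
    using inv by (auto simp: sym_def) metis
  show "trans {(x, y). x \<in> X \<and> y \<in> X \<and> (\<exists>g\<in>G. y = act g x)}"
  proof (rule transI, clarsimp)
    fix x g h assume "x \<in> X" "g \<in> G" "h \<in> G"
    then show "\<exists>k\<in>G. act h (act g x) = act k x"
      using act_mul mul by metis
  qed
qed auto

text \<open>Double count the pairs \<open>(g, x)\<close> with \<open>act g x = x\<close>. Each orbit
  contributes \<open>card G\<close>: as \<open>y\<close> runs over the orbit of \<open>x\<close>,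
  the sets of elements moving \<open>x\<close> to \<open>y\<close> partition \<open>G\<close>, and
  each has as many elements as the stabiliser of \<open>y\<close>.\<close>

lemma burnside:
  fixes act :: "'g \<Rightarrow> 'x \<Rightarrow> 'x"
  assumes fin: "finite G" "finite X"
    and closed: "\<And>g x. g \<in> G \<Longrightarrow> x \<in> X \<Longrightarrow> act g x \<in> X"
    and mul: "\<And>g h. g \<in> G \<Longrightarrow> h \<in> G \<Longrightarrow> mul g h \<in> G"
    and inj: "\<And>h. h \<in> G \<Longrightarrow> inj_on (\<lambda>g. mul g h) G"
    and act_mul: "\<And>g h x. g \<in> G \<Longrightarrow> h \<in> G \<Longrightarrow> x \<in> X \<Longrightarrow> act (mul g h) x = act g (act h x)"
    and unit: "e \<in> G" "\<And>x. x \<in> X \<Longrightarrow> act e x = x"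
    and inv: "\<And>g. g \<in> G \<Longrightarrow> \<exists>h\<in>G. \<forall>x\<in>X. act h (act g x) = x"
  shows "card G * card (X // {(x, y). x \<in> X \<and> y \<in> X \<and> (\<exists>g\<in>G. y = act g x)}) =
    (\<Sum>g\<in>G. card {x \<in> X. act g x = x})"
proof -
  define R where "R = {(x, y). x \<in> X \<and> y \<in> X \<and> (\<exists>g\<in>G. y = act g x)}"
  have eq: "equiv X R"
    unfolding R_def by (rule equiv_orbit_relation[OF mul act_mul unit inv])
  \<comment> \<open>If \<open>a\<close> moves \<open>x\<close> to \<open>y\<close> and
    \<open>b\<close> moves \<open>y\<close> back to \<open>x\<close>, right multiplication by
    \<open>a\<close> and by \<open>b\<close> injects each of the two sets into the other.\<close>
  have stab: "card {g\<in>G. act g y = y} = card {g\<in>G. act g x = y}" if "(x, y) \<in> R" for x y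
  proof (rule antisym)
    from that obtain a where a: "a \<in> G" "y = act a x" and xy: "x \<in> X" "y \<in> X"
      by (auto simp: R_def)
    obtain b where b: "b \<in> G" "act b y = x" using inv a xy by metis
    show "card {g\<in>G. act g y = y} \<le> card {g\<in>G. act g x = y}"
      using a xy mul act_mul fin
      by (intro card_inj_on_le[where f = "\<lambda>g. mul g a"] inj_on_subset[OF inj]) auto
    show "card {g\<in>G. act g x = y} \<le> card {g\<in>G. act g y = y}"
      using b xy mul act_mul fin
      by (intro card_inj_on_le[where f = "\<lambda>g. mul g b"] inj_on_subset[OF inj]) auto
  qed
  have orb: "(\<Sum>y\<in>C. card {g\<in>G. act g y = y}) = card G" if C: "C \<in> X // R" for C
  proof -
    obtain x where x: "x \<in> X" "C = R `` {x}" using C by (auto elim: quotientE)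
    have finC: "finite C" using x fin by (auto simp: R_def intro: finite_subset[of _ X])
    have "(\<Sum>y\<in>C. card {g\<in>G. act g y = y}) = (\<Sum>y\<in>C. card {g\<in>G. act g x = y})"
      using stab x by (intro sum.cong) auto
    also have "\<dots> = (\<Sum>y\<in>C. \<Sum>g | g \<in> G \<and> act g x = y. 1)" by simp
    also have "\<dots> = (\<Sum>g\<in>G. 1)"
      using x closed by (intro sum.group fin finC) (auto simp: R_def)
    finally show ?thesis by simp
  qed
  have "(\<Sum>g\<in>G. card {x \<in> X. act g x = x}) = (\<Sum>g\<in>G. \<Sum>x | x \<in> X \<and> act g x = x. 1)" by simp
  also have "\<dots> = (\<Sum>x\<in>X. \<Sum>g | g \<in> G \<and> act g x = x. 1)"
    using fin by (rule sum.swap_restrict)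
  also have "\<dots> = (\<Sum>x\<in>\<Union>(X // R). card {g\<in>G. act g x = x})"
    using Union_quotient[OF eq] by simp
  also have "\<dots> = (\<Sum>C\<in>X // R. \<Sum>x\<in>C. card {g\<in>G. act g x = x})"
  proof (subst sum.Union_disjoint)
    show "\<forall>A\<in>X // R. finite A"
      using fin eq Union_quotient by (metis Sup_upper finite_subset)
    show "\<forall>A\<in>X // R. \<forall>B\<in>X // R. A \<noteq> B \<longrightarrow> A \<inter> B = {}"
      using quotient_disj[OF eq] by blast
  qed auto
  also have "\<dots> = card G * card (X // R)" using orb by simp
  finally show ?thesis by (simp add: R_def)
qed

text \<open>Image and preimage under \<open>f\<close> are mutually inverse on classes. This replaces
  the infinite set of polygons by the finite set of their tuples.\<close>

lemma card_quotient_surj: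
  assumes surj: "f ` A = B" and eq: "equiv B R"
  shows "card (A // {(x, y). x \<in> A \<and> y \<in> A \<and> (f x, f y) \<in> R}) = card (B // R)"
proof -
  define S where "S = {(x, y). x \<in> A \<and> y \<in> A \<and> (f x, f y) \<in> R}"
  have RB: "R \<subseteq> B \<times> B" using eq by (simp add: equiv_def)
  have cls: "S `` {x} = {y \<in> A. f y \<in> R `` {f x}}" if "x \<in> A" for x
    using that by (auto simp: S_def)
  have "bij_betw (\<lambda>C. f ` C) (A // S) (B // R)"
  proof (rule bij_betwI[where g = "\<lambda>C. {y \<in> A. f y \<in> C}"])
    have im: "f ` (S `` {x}) = R `` {f x}" if "x \<in> A" for x
      using RB surj by (auto simp: cls[OF that] image_iff)
    show "(`) f \<in> A // S \<rightarrow> B // R"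
      using im surj by (auto elim!: quotientE intro!: quotientI)
    show "(\<lambda>C. {y \<in> A. f y \<in> C}) \<in> B // R \<rightarrow> A // S"
    proof
      fix C assume "C \<in> B // R"
      then obtain x where "x \<in> A" "C = R `` {f x}" using surj by (auto elim!: quotientE)
      then show "{y \<in> A. f y \<in> C} \<in> A // S" by (metis cls quotientI)
    qed
    show "{y \<in> A. f y \<in> f ` C} = C" if "C \<in> A // S" for C
      using that by (auto elim!: quotientE simp: im) (auto simp: S_def)
    show "f ` {y \<in> A. f y \<in> C} = C" if "C \<in> B // R" for C
      using that RB surj by (auto elim!: quotientE)
  qed
  then show ?thesis unfolding S_def by (rule bij_betw_same_card)
qed

subsection \<open>Dihedral action on lists\<close>

lemma rev_rotate:
  assumes "k \<le> length xs"
  shows "rev (rotate k xs) = rotate (length xs - k) (rev xs)"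
proof (cases "k = 0 \<or> xs = []")
  case False
  then have "(length xs - k) mod length xs = length xs - k" using assms by simp
  then show ?thesis using assms by (simp add: rotate_rev)
qed auto

definition dih_act :: "nat \<times> bool \<Rightarrow> 'a list \<Rightarrow> 'a list" where
  "dih_act g xs = rotate (fst g) (if snd g then rev xs else xs)"

text \<open>Reversal turns a left rotation by \<open>k\<close> into one by \<open>m - k\<close>, so
  a reflection \<open>g\<close> applied after \<open>h\<close> changes \<open>fst h\<close> to
  \<open>m - fst h\<close>. The inequality of the flags is their sum modulo 2.\<close>

definition dih_mul :: "nat \<Rightarrow> nat \<times> bool \<Rightarrow> nat \<times> bool \<Rightarrow> nat \<times> bool" where
  "dih_mul m g h =
     ((if snd g then fst g + (m - fst h) else fst g + fst h) mod m, snd g \<noteq> snd h)"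

lemma dih_act_mul:
  assumes "length xs = m" "fst h < m"
  shows "dih_act (dih_mul m g h) xs = dih_act g (dih_act h xs)"
proof -
  have "rotate (k mod m) ys = rotate k ys" if "length ys = m" for k and ys :: "'a list"
    using that rotate_conv_mod[of k ys] by simp
  then show ?thesis
    using assms by (auto simp: dih_act_def dih_mul_def rotate_rotate rev_rotate)
qed

lemma inj_dih_mul: "inj_on (\<lambda>g. dih_mul m g h) ({..<m} \<times> UNIV)"
proof -
  have cancel: "a = b" if "a < m" "b < m" "(a + c) mod m = (b + c) mod m" for a b c :: nat
    using that cong_add_rcancel_nat[of a c b m] by (simp add: cong_def)
  show ?thesis
  proof (rule inj_onI, clarify)
    fix k k' :: nat and b b' :: bool
    assume k: "k < m" "k' < m" and eq: "dih_mul m (k, b) h = dih_mul m (k', b') h"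
    then have "b = b'" by (auto simp: dih_mul_def)
    with eq k cancel[of k k' "m - fst h"] cancel[of k k' "fst h"] show "k = k' \<and> b = b'"
      by (cases b') (simp_all add: dih_mul_def)
  qed
qed

lemma dihedral_eq_iff_dih_act:
  assumes "length xs = m" "m > 0"
  shows "dihedral_eq xs ys \<longleftrightarrow> (\<exists>g\<in>{..<m} \<times> UNIV. ys = dih_act g xs)"
proof
  assume "dihedral_eq xs ys"
  then obtain k b where "ys = rotate k (if b then rev xs else xs)"
    unfolding dihedral_eq_def by (metis (full_types))
  moreover have "length (if b then rev xs else xs) = m" using assms by simp
  ultimately have "ys = rotate (k mod m) (if b then rev xs else xs)"
    by (metis rotate_conv_mod)
  then show "\<exists>g\<in>{..<m} \<times> UNIV. ys = dih_act g xs"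
    using assms by (intro bexI[of _ "(k mod m, b)"]) (auto simp: dih_act_def)
qed (auto simp: dihedral_eq_def dih_act_def split: if_splits)

lemma dih_act_inv:
  assumes "g \<in> {..<m} \<times> UNIV"
  shows "\<exists>h\<in>{..<m} \<times> UNIV. \<forall>xs. length xs = m \<longrightarrow> dih_act h (dih_act g xs) = xs"
proof -
  obtain k b where g: "g = (k, b)" "k < m" using assms by auto
  \<comment> \<open>Reflections are involutions. For rotations, the reduction modulo
    \<open>m\<close> keeps the index in range when \<open>k = 0\<close>.\<close>
  define h where "h = (if b then k else (m - k) mod m, b)"
  have "dih_act h (dih_act g xs) = xs" if "length xs = m" for xs :: "'b list"
  proof (cases b)
    case True
    then show ?thesis using g that by (simp add: h_def dih_act_def rev_rotate rotate_rotate)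
  next
    case False
    have "rotate ((m - k) mod m) (rotate k xs) = rotate (m - k) (rotate k xs)"
      using that by (metis length_rotate rotate_conv_mod)
    then show ?thesis using g that False by (simp add: h_def dih_act_def rotate_rotate)
  qed
  moreover have "h \<in> {..<m} \<times> UNIV" using g by (auto simp: h_def)
  ultimately show ?thesis by blast
qed

lemma card_dihedral_classes:
  fixes X :: "'a list set"
  assumes fin: "finite X" and m: "m > 0" and len: "\<And>xs. xs \<in> X \<Longrightarrow> length xs = m"
    and rot: "\<And>k xs. xs \<in> X \<Longrightarrow> rotate k xs \<in> X" and rv: "\<And>xs. xs \<in> X \<Longrightarrow> rev xs \<in> X"
  shows "equiv X {(xs, ys). xs \<in> X \<and> ys \<in> X \<and> dihedral_eq xs ys}" (is ?A)
    and "2 * m * card (X // {(xs, ys). xs \<in> X \<and> ys \<in> X \<and> dihedral_eq xs ys}) =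
      (\<Sum>k<m. card {xs \<in> X. rotate k xs = xs}) + (\<Sum>k<m. card {xs \<in> X. rotate k (rev xs) = xs})"
      (is ?B)
proof -
  let ?G = "{..<m} \<times> (UNIV :: bool set)"
  have R: "{(xs, ys). xs \<in> X \<and> ys \<in> X \<and> dihedral_eq xs ys} =
    {(xs, ys). xs \<in> X \<and> ys \<in> X \<and> (\<exists>g\<in>?G. ys = dih_act g xs)}"
    using dihedral_eq_iff_dih_act[OF len m] by auto
  have act: "dih_act g xs \<in> X" if "g \<in> ?G" "xs \<in> X" for g xs
    using that rot rv by (simp add: dih_act_def)
  have mul: "dih_mul m g h \<in> ?G" if "g \<in> ?G" "h \<in> ?G" for g h
    using m by (auto simp: dih_mul_def)
  have act_mul: "dih_act (dih_mul m g h) xs = dih_act g (dih_act h xs)"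
    if "g \<in> ?G" "h \<in> ?G" "xs \<in> X" for g h xs
    using that len by (intro dih_act_mul) auto
  have inv: "\<exists>h\<in>?G. \<forall>x\<in>X. dih_act h (dih_act g x) = x" if "g \<in> ?G" for g
    using dih_act_inv[OF that] len by metis
  have unit: "(0, False) \<in> ?G" "\<And>xs. xs \<in> X \<Longrightarrow> dih_act (0, False) xs = xs"
    using m by (auto simp: dih_act_def)
  show ?A unfolding R by (rule equiv_orbit_relation[OF mul act_mul unit inv])
  have "card ?G * card (X // {(xs, ys). xs \<in> X \<and> ys \<in> X \<and> dihedral_eq xs ys}) =
    (\<Sum>g\<in>?G. card {xs \<in> X. dih_act g xs = xs})"
    unfolding R using fin
    by (intro burnside[where act = dih_act and mul = "dih_mul m", OF _ _ act mul inj_dih_mul act_mul unit inv]) auto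
  also have "\<dots> = (\<Sum>k<m. \<Sum>b\<in>UNIV. card {xs \<in> X. dih_act (k, b) xs = xs})"
    by (simp add: sum.cartesian_product)
  also have "card ?G = 2 * m" by (simp add: card_cartesian_product)
  finally show ?B
    by (simp add: UNIV_bool dih_act_def sum.distrib add.commute)
qed

subsection \<open>Lists of positive integers with prescribed sum\<close>

definition pos_lists :: "nat \<Rightarrow> nat \<Rightarrow> nat list set" where
  "pos_lists h N = {xs. length xs = h \<and> 0 \<notin> set xs \<and> sum_list xs \<le> N}"

definition compositions :: "nat \<Rightarrow> nat \<Rightarrow> nat list set" where
  "compositions h n = {xs. length xs = h \<and> 0 \<notin> set xs \<and> sum_list xs = n}"

lemma finite_pos_lists: "finite (pos_lists h N)"
proof (rule finite_subset)
  show "pos_lists h N \<subseteq> {xs. set xs \<subseteq> {..N} \<and> length xs = h}"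
    using member_le_sum_list by (fastforce simp: pos_lists_def intro: order_trans)
qed (simp add: finite_lists_length_eq)

lemma finite_compositions: "finite (compositions h n)"
  by (rule finite_subset[OF _ finite_pos_lists[of h n]]) (auto simp: pos_lists_def compositions_def)

text \<open>Partial sums turn these lists into \<open>h\<close>-element subsets of
  \<open>{1..N}\<close>. The formal count instead splits off the first entry and applies the
  hockey-stick identity.\<close>

lemma card_pos_lists: "card (pos_lists h N) = N choose h"
proof (induction h arbitrary: N)
  case 0
  have "pos_lists 0 N = {[]}" by (auto simp: pos_lists_def)
  then show ?case by simp
next
  case (Suc h)
  have "pos_lists (Suc h) N = (\<Union>a\<in>{1..N}. (#) a ` pos_lists h (N - a))" (is "?L = ?R")
  proof (intro equalityI subsetI)
    fix xs assume "xs \<in> ?L"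
    then obtain a ys where "xs = a # ys" "a \<in> {1..N}" "ys \<in> pos_lists h (N - a)"
      by (cases xs) (auto simp: pos_lists_def)
    then show "xs \<in> ?R" by blast
  qed (auto simp: pos_lists_def)
  then have "card (pos_lists (Suc h) N) = (\<Sum>a\<in>{1..N}. card ((#) a ` pos_lists h (N - a)))"
    by (simp only:) (intro card_UN_disjoint; auto simp: finite_pos_lists)
  also have "\<dots> = (\<Sum>a\<in>{1..N}. (N - a) choose h)"
    by (simp add: card_image Suc.IH)
  also have "\<dots> = (\<Sum>j<N. j choose h)"
    by (rule sum.reindex_bij_witness[of _ "\<lambda>j. N - j" "\<lambda>a. N - a"]) auto
  also have "\<dots> = N choose Suc h"
    by (cases N) (simp_all only: lessThan_Suc_atMost sum_choose_upper, simp)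
  finally show ?case .
qed

text \<open>The first entry is determined by the others, whose sum may be anything up to
  \<open>n - 1\<close>.\<close>

lemma card_compositions:
  assumes "h > 0" "n > 0"
  shows "card (compositions h n) = (n - 1) choose (h - 1)"
proof -
  have "bij_betw (\<lambda>ys. (n - sum_list ys) # ys) (pos_lists (h - 1) (n - 1)) (compositions h n)"
  proof (rule bij_betw_byWitness[where f' = tl], safe)
    fix xs assume "xs \<in> compositions h n"
    then show "(n - sum_list (tl xs)) # tl xs = xs" "tl xs \<in> pos_lists (h - 1) (n - 1)"
      using assms by (cases xs; auto simp: compositions_def pos_lists_def)+
  qed (use assms in \<open>auto simp: compositions_def pos_lists_def\<close>)
  then show ?thesis using bij_betw_same_card card_pos_lists by metis
qed

lemma sum_list_pos_if_zero_notin: "0 \<notin> set xs \<Longrightarrow> xs \<noteq> [] \<Longrightarrow> 0 < sum_list (xs :: nat list)"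
  by (cases xs) auto

lemma member_less_sum_list:
  fixes xs :: "nat list"
  assumes "a \<in> set xs" "0 \<notin> set xs" "length xs \<ge> 2"
  shows "a < sum_list xs"
proof -
  obtain us vs where xs: "xs = us @ a # vs" using assms split_list by metis
  then have "us @ vs \<noteq> []" using assms by auto
  then have "0 < sum_list (us @ vs)" using assms xs by (intro sum_list_pos_if_zero_notin) auto
  then show ?thesis using xs by simp
qed

lemma sum_list_rotate [simp]: "sum_list (rotate k xs) = sum_list (xs :: nat list)"
proof (induction k)
  case (Suc k)
  have "sum_list (rotate1 ys) = sum_list ys" for ys :: "nat list" by (cases ys) auto
  with Suc show ?case by simp
qed simp

section \<open>Compositions with all parts below half the sum\<close>

definition polygon_lists :: "nat \<Rightarrow> nat \<Rightarrow> nat list set" where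
  "polygon_lists m n = {xs \<in> compositions m n. \<forall>a\<in>set xs. 2 * a < n}"

lemma finite_polygon_lists: "finite (polygon_lists m n)"
  by (simp add: polygon_lists_def finite_compositions)

lemma rotate_in_polygon_lists: "xs \<in> polygon_lists m n \<Longrightarrow> rotate k xs \<in> polygon_lists m n"
  by (simp add: polygon_lists_def compositions_def)

lemma rev_in_polygon_lists: "xs \<in> polygon_lists m n \<Longrightarrow> rev xs \<in> polygon_lists m n"
  by (simp add: polygon_lists_def compositions_def)

text \<open>Some third entry contributes a positive amount. Hence two entries can never both reach
  half the sum.\<close>

lemma two_nth_less_sum_list:
  fixes xs :: "nat list"
  assumes "i < length xs" "j < length xs" "i \<noteq> j" "0 \<notin> set xs" "length xs \<ge> 3"
  shows "xs ! i + xs ! j < sum_list xs"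
proof -
  have "card {i, j} < card {..<length xs}" using assms by (auto simp: card_insert_if)
  then have "\<not> {..<length xs} \<subseteq> {i, j}" using card_mono[of "{i, j}" "{..<length xs}"] by auto
  then obtain l where l: "l < length xs" "l \<noteq> i" "l \<noteq> j" by auto
  have "xs ! l \<noteq> 0" using l assms by (metis nth_mem)
  moreover have "(\<Sum>k\<in>{i, j, l}. xs ! k) \<le> (\<Sum>k<length xs. xs ! k)"
    using l assms by (intro sum_mono2) auto
  moreover have "(\<Sum>k<length xs. xs ! k) = sum_list xs"
    by (simp add: sum_list_sum_nth atLeast0LessThan)
  ultimately show ?thesis using l assms by auto
qed

text \<open>A composition violating the bound has exactly one part of size at least
  \<open>n / 2\<close>. Its \<open>m\<close> possible positions give disjoint sets
  \<open>B i\<close>, each carried onto \<open>B 0\<close> by a rotation. The additive form avoids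
  truncated subtraction.\<close>

lemma card_polygon_lists:
  assumes "3 \<le> m" "0 < n"
  shows "card (polygon_lists m n) + m * ((n div 2) choose (m - 1)) = (n - 1) choose (m - 1)"
proof -
  define B where "B i = {xs \<in> compositions m n. n \<le> 2 * xs ! i}" for i
  have finB: "finite (B i)" for i by (simp add: B_def finite_compositions)
  have B0: "card (B 0) = (n div 2) choose (m - 1)"
  proof -
    \<comment> \<open>The first entry \<open>n - sum_list ys\<close> is at least half of
      \<open>n\<close> exactly when \<open>sum_list ys\<close> is at most
      \<open>n div 2\<close>.\<close>
    have "bij_betw (\<lambda>ys. (n - sum_list ys) # ys) (pos_lists (m - 1) (n div 2)) (B 0)"
    proof (rule bij_betw_byWitness[where f' = tl], safe)
      fix xs assume "xs \<in> B 0"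
      then show "(n - sum_list (tl xs)) # tl xs = xs" "tl xs \<in> pos_lists (m - 1) (n div 2)"
        using assms by (cases xs; auto simp: B_def compositions_def pos_lists_def)+
    qed (use assms in \<open>auto simp: B_def compositions_def pos_lists_def\<close>)
    then show ?thesis using bij_betw_same_card card_pos_lists by metis
  qed
  have Bi: "card (B i) = card (B 0)" if "i < m" for i
  proof -
    have "bij_betw (rotate i) (B i) (B 0)"
    proof (rule bij_betw_byWitness[where f' = "rotate (m - i)"], safe)
      fix xs assume "xs \<in> B i"
      then show "rotate (m - i) (rotate i xs) = xs" "rotate i xs \<in> B 0"
        using that by (auto simp: B_def compositions_def rotate_rotate nth_rotate)
    next
      fix xs assume "xs \<in> B 0"
      then show "rotate i (rotate (m - i) xs) = xs" "rotate (m - i) xs \<in> B i"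
        using that by (auto simp: B_def compositions_def rotate_rotate nth_rotate)
    qed
    then show ?thesis by (rule bij_betw_same_card)
  qed
  have disj: "B i \<inter> B j = {}" if "i < m" "j < m" "i \<noteq> j" for i j
    using that assms two_nth_less_sum_list[of i _ j] by (fastforce simp: B_def compositions_def)
  have split: "compositions m n = polygon_lists m n \<union> (\<Union>i<m. B i)"
  proof (intro equalityI subsetI)
    fix xs assume xs: "xs \<in> compositions m n"
    show "xs \<in> polygon_lists m n \<union> (\<Union>i<m. B i)"
    proof (cases "xs \<in> polygon_lists m n")
      case False
      then obtain i where "i < length xs" "n \<le> 2 * xs ! i"
        using xs by (auto simp: polygon_lists_def in_set_conv_nth not_less)
      then show ?thesis using xs by (auto simp: B_def compositions_def)
    qed simp
  qed (auto simp: polygon_lists_def B_def)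
  have "card (compositions m n) = card (polygon_lists m n) + card (\<Union>i<m. B i)"
  proof (subst split, rule card_Un_disjoint)
    show "polygon_lists m n \<inter> (\<Union>i<m. B i) = {}"
    proof (safe, simp)
      fix xs i assume "xs \<in> polygon_lists m n" "i < m" "xs \<in> B i"
      moreover then have "xs ! i \<in> set xs" by (auto simp: B_def compositions_def)
      ultimately show False by (auto simp: polygon_lists_def B_def)
    qed
  qed (auto simp: finite_polygon_lists finB)
  also have "card (\<Union>i<m. B i) = (\<Sum>i<m. card (B i))"
    using disj finB by (intro card_UN_disjoint) auto
  also have "\<dots> = m * ((n div 2) choose (m - 1))" using Bi B0 by simp
  finally show ?thesis using card_compositions[of m n] assms by simp
qed

subsection \<open>Lists fixed by a rotation\<close>

lemma rotate_mult_fixed: "rotate k xs = xs \<Longrightarrow> rotate (k * j) xs = xs"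
  by (induction j) (simp_all add: rotate_add)

text \<open>By Bezout some multiple of \<open>k\<close> is a multiple of the length plus the gcd,
  and rotation by the length is the identity.\<close>

lemma rotate_fixed_gcd: "rotate k xs = xs \<longleftrightarrow> rotate (gcd k (length xs)) xs = xs"
proof
  assume fix_k: "rotate k xs = xs"
  show "rotate (gcd k (length xs)) xs = xs"
  proof (cases "k = 0")
    case False
    then obtain x y where xy: "k * x = length xs * y + gcd k (length xs)"
      using bezout_nat by blast
    have "rotate (gcd k (length xs) + length xs * y) xs = xs"
      using rotate_mult_fixed[OF fix_k, of x] xy by (simp add: add.commute)
    then show ?thesis by (simp add: rotate_rotate[symmetric])
  qed simp
next
  assume fixed: "rotate (gcd k (length xs)) xs = xs"
  obtain c where "k = gcd k (length xs) * c" by (meson dvdE gcd_dvd1)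
  then show "rotate k xs = xs" using rotate_mult_fixed[OF fixed] by metis
qed

text \<open>Comparing prefixes shows that \<open>vs\<close> starts with \<open>us\<close>; what
  remains still commutes with \<open>us\<close>, so blocks can be peeled off one by one.\<close>

lemma commuting_append_replicate:
  assumes "us @ vs = vs @ us" "length vs = d * length us"
  shows "vs = concat (replicate d us)"
  using assms
proof (induction d arbitrary: vs)
  case (Suc d)
  have "take (length us) (us @ vs) = take (length us) (vs @ us)" using Suc.prems by (simp only:)
  moreover have "length us \<le> length vs" using Suc.prems by simp
  ultimately have "us = take (length us) vs" by simp
  then obtain ws where vs: "vs = us @ ws" by (metis append_take_drop_id)
  with Suc.prems have "us @ ws = ws @ us" "length ws = d * length us" by auto
  then show ?case using Suc.IH vs by simp
qed simp

lemma rotate_concat_replicate: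
  "rotate (length ys) (concat (replicate d ys)) = concat (replicate d ys)"
proof (cases d)
  case (Suc e)
  have "concat (replicate e ys) @ ys = ys @ concat (replicate e ys)" by (induction e) auto
  then show ?thesis using rotate_append[of ys "concat (replicate e ys)"] Suc by simp
qed simp

text \<open>Rotation by \<open>g\<close> moves the first block behind the rest, so invariance means
  that this block commutes with the rest.\<close>

lemma rotate_fixed_iff_replicate:
  assumes "length xs = g * d" "d > 0"
  shows "rotate g xs = xs \<longleftrightarrow> xs = concat (replicate d (take g xs))"
proof
  assume fixed: "rotate g xs = xs"
  define us vs where "us = take g xs" and "vs = drop g xs"
  obtain e where e: "d = Suc e" using assms by (cases d) auto
  have len: "length us = g" "length vs = e * length us" using assms e by (auto simp: us_def vs_def)
  have xs: "xs = us @ vs" by (simp add: us_def vs_def)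
  with fixed len have "vs @ us = us @ vs" using rotate_append[of us vs] by simp
  then have "vs = concat (replicate e us)" using len by (intro commuting_append_replicate) auto
  then have "xs = concat (replicate d us)" using xs e by simp
  then show "xs = concat (replicate d (take g xs))" by (simp only: us_def)
next
  assume eq: "xs = concat (replicate d (take g xs))"
  have "length (take g xs) = g" using assms by simp
  then show "rotate g xs = xs" using rotate_concat_replicate[of "take g xs" d] eq by metis
qed

lemma sum_list_concat_replicate: "sum_list (concat (replicate d ys)) = d * sum_list (ys :: nat list)"
  by (induction d) auto

lemma length_concat_replicate: "length (concat (replicate d ys)) = d * length ys"
  by (induction d) auto

text \<open>A fixed tuple is determined by its first \<open>g\<close> entries, which may form any
  composition of \<open>n / d\<close>.\<close>

lemma card_rotation_fixed_proper:
  assumes m: "m = g * d" "3 \<le> m" and d: "2 \<le> d" and n: "0 < n"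
  shows "card {xs \<in> polygon_lists m n. rotate g xs = xs} =
    (if d dvd n then (n div d - 1) choose (g - 1) else 0)"
proof -
  have g: "g > 0" using m by (cases g) auto
  define S where "S = {ys. length ys = g \<and> 0 \<notin> set ys \<and> d * sum_list ys = n}"
  have "bij_betw (\<lambda>ys. concat (replicate d ys)) S {xs \<in> polygon_lists m n. rotate g xs = xs}"
  proof (rule bij_betw_byWitness[where f' = "take g"], safe)
    fix ys assume ys: "ys \<in> S"
    show "take g (concat (replicate d ys)) = ys"
      using ys d by (cases d) (auto simp: S_def)
    show "rotate g (concat (replicate d ys)) = concat (replicate d ys)"
      using ys rotate_concat_replicate[of ys d] by (auto simp: S_def)
    have "2 * a < n" if a: "a \<in> set ys" for a
    \<comment> \<open>For larger \<open>d\<close> the sum of a whole block is already below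
      \<open>n / 2\<close>. For \<open>d = 2\<close> it equals \<open>n / 2\<close>, but since
      \<open>m\<close> is at least 3 a block has two or more entries, each smaller than the block
      sum.\<close>
    proof (cases "d = 2")
      case True
      then have "a < sum_list ys" using ys a m by (intro member_less_sum_list) (auto simp: S_def)
      then show ?thesis using True ys by (auto simp: S_def)
    next
      case False
      have "0 < sum_list ys" using n ys by (cases "sum_list ys") (auto simp: S_def)
      then have "2 * sum_list ys < d * sum_list ys" using False d by simp
      also have "\<dots> = n" using ys by (simp add: S_def)
      finally show ?thesis using member_le_sum_list[OF a] by linarith
    qed
    then show "concat (replicate d ys) \<in> polygon_lists m n"
      using ys m by (auto simp: S_def polygon_lists_def compositions_def
          sum_list_concat_replicate length_concat_replicate)
  next
    fix xs assume xs: "xs \<in> polygon_lists m n" "rotate g xs = xs"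
    then have eq: "xs = concat (replicate d (take g xs))"
      using m d by (subst (asm) rotate_fixed_iff_replicate[of _ _ d])
        (auto simp: polygon_lists_def compositions_def)
    then show "concat (replicate d (take g xs)) = xs" by simp
    have "d * sum_list (take g xs) = sum_list xs"
      by (metis eq sum_list_concat_replicate)
    then show "take g xs \<in> S"
      using xs m d by (auto simp: S_def polygon_lists_def compositions_def dest: in_set_takeD)
  qed
  then have "card {xs \<in> polygon_lists m n. rotate g xs = xs} = card S"
    by (simp add: bij_betw_same_card)
  also have "\<dots> = (if d dvd n then (n div d - 1) choose (g - 1) else 0)"
  proof (cases "d dvd n")
    case True
    then have "S = compositions g (n div d)" using d by (auto simp: S_def compositions_def)
    moreover have "n div d > 0" using True n d by (auto simp: dvd_def)
    ultimately show ?thesis using True card_compositions[of g] g by simp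
  next
    case False
    then have "S = {}" by (auto simp: S_def)
    then show ?thesis using False by simp
  qed
  finally show ?thesis .
qed

text \<open>The absorption identity rewrites the lowered binomial coefficients as
  \<open>m / n\<close> times those of the final formula. Only the identity, \<open>d = 1\<close>,
  carries the correction for parts of size at least \<open>n / 2\<close>.\<close>

lemma card_rotation_fixed:
  assumes m: "3 \<le> m" "m \<le> n" and d: "d dvd m"
  shows "real (card {xs \<in> polygon_lists m n. rotate (m div d) xs = xs}) =
    (if d dvd n then real m / real n * real ((n div d) choose (m div d)) else 0)
    - (if d = 1 then real m * real ((n div 2) choose (m - 1)) else 0)"
proof -
  have d0: "d > 0" using m d by (intro Nat.gr0I) auto
  have absorb: "real ((n div d - 1) choose (m div d - 1)) = real m / real n * real ((n div d) choose (m div d))"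
    if "d dvd n"
  proof -
    have "m div d > 0" using m d d0 by (simp add: div_greater_zero_iff dvd_imp_le)
    then have "(m div d) * ((n div d) choose (m div d)) = (n div d) * ((n div d - 1) choose (m div d - 1))"
      by (rule times_binomial_minus1_eq)
    then have "real (m div d) * real ((n div d) choose (m div d)) =
      real (n div d) * real ((n div d - 1) choose (m div d - 1))"
      by (simp only: flip: of_nat_mult)
    then show ?thesis using d that d0 m by (simp add: real_of_nat_div field_simps)
  qed
  show ?thesis
  proof (cases "d = 1")
    case True
    have "rotate m xs = xs" if "xs \<in> polygon_lists m n" for xs
      using that by (simp add: polygon_lists_def compositions_def)
    then have "{xs \<in> polygon_lists m n. rotate (m div d) xs = xs} = polygon_lists m n"
      using True by auto
    moreover have "real (card (polygon_lists m n)) + real m * real ((n div 2) choose (m - 1)) =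
      real ((n - 1) choose (m - 1))"
      using card_polygon_lists[of m n] m by (simp flip: of_nat_mult of_nat_add)
    ultimately show ?thesis using True absorb by simp
  next
    case False
    then have "card {xs \<in> polygon_lists m n. rotate (m div d) xs = xs} =
      (if d dvd n then (n div d - 1) choose (m div d - 1) else 0)"
      using m d d0 by (intro card_rotation_fixed_proper) auto
    then show ?thesis using False absorb by simp
  qed
qed

text \<open>Exactly \<open>totient (m div g)\<close> indices have gcd \<open>g\<close> with
  \<open>m\<close>; then pass to the complementary divisor.\<close>

lemma sum_gcd_eq_sum_totient:
  fixes f :: "nat \<Rightarrow> real"
  assumes "m > 0"
  shows "(\<Sum>k<m. f (gcd k m)) = (\<Sum>d | d dvd m. real (totient d) * f (m div d))"
proof -
  \<comment> \<open>Index 0 is traded for index \<open>m\<close>, which has the same gcd, to match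
    the range of the totient count.\<close>
  have "(\<Sum>k<m. f (gcd k m)) = (\<Sum>k\<in>{0<..m}. f (gcd k m))"
    using assms by (intro sum.reindex_bij_witness[of _ "\<lambda>k. if k = m then 0 else k" "\<lambda>k. if k = 0 then m else k"])
      (auto split: if_splits)
  also have "\<dots> = (\<Sum>g | g dvd m. \<Sum>k | k \<in> {0<..m} \<and> gcd k m = g. f (gcd k m))"
    using assms by (intro sum.group[symmetric]) auto
  also have "\<dots> = (\<Sum>g | g dvd m. real (totient (m div g)) * f g)"
  proof (intro sum.cong refl)
    fix g assume "g \<in> {g. g dvd m}"
    then have "card {k. k \<in> {0<..m} \<and> gcd k m = g} = totient (m div g)"
      using assms by (intro card_gcd_eq_totient) auto
    moreover have "(\<Sum>k | k \<in> {0<..m} \<and> gcd k m = g. f (gcd k m)) =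
      (\<Sum>k | k \<in> {0<..m} \<and> gcd k m = g. f g)" by (rule sum.cong) auto
    ultimately show "(\<Sum>k | k \<in> {0<..m} \<and> gcd k m = g. f (gcd k m)) = real (totient (m div g)) * f g"
      by simp
  qed
  also have "\<dots> = (\<Sum>d | d dvd m. real (totient d) * f (m div d))"
    using assms by (intro sum.reindex_bij_witness[of _ "\<lambda>d. m div d" "\<lambda>d. m div d"])
      (auto simp: dvd_div_eq_iff elim!: dvdE)
  finally show ?thesis .
qed

lemma sum_card_rotation_fixed:
  assumes m: "3 \<le> m" "m \<le> n"
  shows "(\<Sum>k<m. real (card {xs \<in> polygon_lists m n. rotate k xs = xs})) =
    (\<Sum>d | d dvd gcd m n. real (totient d) * (real m / real n) * real ((n div d) choose (m div d)))
    - real m * real ((n div 2) choose (m - 1))"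
proof -
  have fin: "finite {d. d dvd m}" using m by simp
  have "{xs \<in> polygon_lists m n. rotate k xs = xs} = {xs \<in> polygon_lists m n. rotate (gcd k m) xs = xs}" for k
    using rotate_fixed_gcd[of k] by (auto simp: polygon_lists_def compositions_def)
  then have "(\<Sum>k<m. real (card {xs \<in> polygon_lists m n. rotate k xs = xs})) =
    (\<Sum>k<m. real (card {xs \<in> polygon_lists m n. rotate (gcd k m) xs = xs}))" by simp
  also have "\<dots> = (\<Sum>d | d dvd m. real (totient d) * real (card {xs \<in> polygon_lists m n. rotate (m div d) xs = xs}))"
    using m by (intro sum_gcd_eq_sum_totient) auto
  also have "\<dots> = (\<Sum>d | d dvd m. (if d dvd n then real (totient d) * (real m / real n) * real ((n div d) choose (m div d)) else 0)
      - (if d = 1 then real m * real ((n div 2) choose (m - 1)) else 0))"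
    using m by (intro sum.cong) (auto simp: card_rotation_fixed right_diff_distrib)
  also have "\<dots> = (\<Sum>d | d dvd m. if d dvd n then real (totient d) * (real m / real n) * real ((n div d) choose (m div d)) else 0)
      - real m * real ((n div 2) choose (m - 1))"
    using fin by (simp add: sum_subtractf)
  also have "(\<Sum>d | d dvd m. if d dvd n then real (totient d) * (real m / real n) * real ((n div d) choose (m div d)) else 0)
    = (\<Sum>d | d dvd gcd m n. real (totient d) * (real m / real n) * real ((n div d) choose (m div d)))"
    using fin by (subst sum.inter_filter[symmetric]) (auto intro!: sum.cong)
  finally show ?thesis .
qed

subsection \<open>Lists fixed by a reflection\<close>

definition reflection_fixed :: "nat \<Rightarrow> nat \<Rightarrow> nat \<Rightarrow> nat list set" where
  "reflection_fixed m n k = {xs \<in> polygon_lists m n. rotate k (rev xs) = xs}"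

lemma finite_reflection_fixed: "finite (reflection_fixed m n k)"
  by (simp add: reflection_fixed_def finite_polygon_lists)

lemma reflection_fixed_mod:
  assumes "k mod m = l mod m"
  shows "reflection_fixed m n k = reflection_fixed m n l"
proof -
  have "rotate k ys = rotate l ys" if "length ys = m" for ys :: "nat list"
    using that assms rotate_conv_mod by metis
  then show ?thesis by (auto simp: reflection_fixed_def polygon_lists_def compositions_def)
qed

text \<open>Rotation by \<open>j\<close> conjugates the reflection with index \<open>k\<close> into
  the one with index \<open>k + 2 * j\<close>.\<close>

lemma card_reflection_fixed_le:
  assumes "j \<le> m"
  shows "card (reflection_fixed m n k) \<le> card (reflection_fixed m n (k + 2 * j))"
proof (rule card_inj_on_le)
  have len: "length xs = m" if "xs \<in> polygon_lists m n" for xs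
    using that by (simp add: polygon_lists_def compositions_def)
  show "inj_on (rotate j) (reflection_fixed m n k)"
  proof (rule inj_on_inverseI)
    fix xs assume "xs \<in> reflection_fixed m n k"
    then show "rotate (m - j) (rotate j xs) = xs"
      using assms len by (simp add: reflection_fixed_def rotate_rotate)
  qed
  show "rotate j ` reflection_fixed m n k \<subseteq> reflection_fixed m n (k + 2 * j)"
  proof safe
    fix xs assume "xs \<in> reflection_fixed m n k"
    then have xs: "xs \<in> polygon_lists m n" "rotate k (rev xs) = xs"
      by (auto simp: reflection_fixed_def)
    have "rotate (k + 2 * j) (rev (rotate j xs)) = rotate (k + 2 * j + (m - j)) (rev xs)"
      using len[OF xs(1)] assms by (simp add: rev_rotate rotate_rotate)
    also have "k + 2 * j + (m - j) = j + k + m" using assms by simp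
    also have "rotate (j + k + m) (rev xs) = rotate (j + k) (rev xs)"
      using len[OF xs(1)] by (simp add: rotate_add)
    also have "\<dots> = rotate j xs" using xs by (simp add: rotate_add)
    finally show "rotate j xs \<in> reflection_fixed m n (k + 2 * j)"
      using xs by (simp add: reflection_fixed_def rotate_in_polygon_lists)
  qed
qed (rule finite_reflection_fixed)

text \<open>One inequality is conjugation with \<open>j = 1\<close>. For the other,
  \<open>m - 1\<close> further steps of 2 lead from \<open>k + 2\<close> to
  \<open>k + 2 * m\<close>, which is the reflection \<open>k\<close> again.\<close>

lemma card_reflection_fixed_add_2:
  assumes "m > 0"
  shows "card (reflection_fixed m n (k + 2)) = card (reflection_fixed m n k)"
proof (rule antisym)
  show "card (reflection_fixed m n k) \<le> card (reflection_fixed m n (k + 2))"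
    using card_reflection_fixed_le[of 1 m n k] assms by simp
  have "k + 2 + 2 * (m - 1) = k + 2 * m" using assms by simp
  then have "(k + 2 + 2 * (m - 1)) mod m = k mod m" by (simp only: mod_mult_self1)
  then have "reflection_fixed m n (k + 2 + 2 * (m - 1)) = reflection_fixed m n k"
    by (rule reflection_fixed_mod)
  then show "card (reflection_fixed m n (k + 2)) \<le> card (reflection_fixed m n k)"
    using card_reflection_fixed_le[of "m - 1" m n "k + 2"] by simp
qed

lemma card_reflection_fixed_parity:
  assumes "m > 0"
  shows "card (reflection_fixed m n k) = card (reflection_fixed m n (k mod 2))"
proof (induction k rule: less_induct)
  case (less k)
  show ?case
  proof (cases "k < 2")
    case False
    then obtain l where "k = l + 2" by (metis add.commute le_Suc_ex not_less)
    then show ?thesis using less.IH[of l] card_reflection_fixed_add_2[OF assms] by simp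
  qed simp
qed

section \<open>Palindromic tuples\<close>

lemma rev_fixed_even:
  assumes "length xs = 2 * h"
  shows "rev xs = xs \<longleftrightarrow> xs = take h xs @ rev (take h xs)"
proof
  assume p: "rev xs = xs"
  have "drop h xs = rev (take h (rev xs))" using assms by (simp add: take_rev)
  then show "xs = take h xs @ rev (take h xs)" using p by (metis append_take_drop_id)
next
  assume "xs = take h xs @ rev (take h xs)"
  then show "rev xs = xs" by (metis rev_append rev_rev_ident)
qed

lemma rev_fixed_odd:
  assumes "length xs = 2 * h + 1"
  shows "rev xs = xs \<longleftrightarrow> xs = take h xs @ [xs ! h] @ rev (take h xs)"
proof
  assume p: "rev xs = xs"
  have "drop (h + 1) xs = rev (take h (rev xs))" using assms by (simp add: take_rev)
  moreover have "xs = take h xs @ [xs ! h] @ drop (h + 1) xs"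
    using assms by (simp add: id_take_nth_drop)
  ultimately show "xs = take h xs @ [xs ! h] @ rev (take h xs)" using p by metis
next
  assume "xs = take h xs @ [xs ! h] @ rev (take h xs)"
  then have "rev xs = rev (take h xs @ [xs ! h] @ rev (take h xs))" by (rule arg_cong)
  also have "\<dots> = take h xs @ [xs ! h] @ rev (take h xs)" by simp
  finally show "rev xs = xs" using \<open>xs = take h xs @ [xs ! h] @ rev (take h xs)\<close> by simp
qed

text \<open>If the first half has sum \<open>s\<close>, the middle entry is
  \<open>n - 2 * s\<close>. It is positive iff \<open>s\<close> is at most
  \<open>(n - 1) div 2\<close>, and less than \<open>n / 2\<close> iff \<open>s\<close> exceeds
  \<open>n div 4\<close>. The other entries occur twice, so they satisfy the bound
  automatically.\<close>

lemma card_palindromes_odd: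
  assumes "m = 2 * h + 1" "h > 0" "0 < n"
  shows "card (reflection_fixed m n 0) + ((n div 4) choose h) = ((n - 1) div 2) choose h"
proof -
  have "bij_betw (\<lambda>zs. zs @ [n - 2 * sum_list zs] @ rev zs)
    (pos_lists h ((n - 1) div 2) - pos_lists h (n div 4)) (reflection_fixed m n 0)"
  proof (rule bij_betw_byWitness[where f' = "take h"], safe)
    fix zs assume zs: "zs \<in> pos_lists h ((n - 1) div 2)" "zs \<notin> pos_lists h (n div 4)"
    then show "take h (zs @ [n - 2 * sum_list zs] @ rev zs) = zs" by (simp add: pos_lists_def)
    have z: "2 * sum_list zs < n" "n < 4 * sum_list zs"
      using zs assms by (auto simp: pos_lists_def)
    have "2 * a < n" if "a \<in> set zs" for a
      using member_le_sum_list[OF that] z by simp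
    then show "zs @ [n - 2 * sum_list zs] @ rev zs \<in> reflection_fixed m n 0"
      using zs z assms
      by (auto simp: reflection_fixed_def polygon_lists_def compositions_def pos_lists_def)
  next
    fix xs assume "xs \<in> reflection_fixed m n 0"
    then have xs: "length xs = 2 * h + 1" "0 \<notin> set xs" "sum_list xs = n" "\<forall>a\<in>set xs. 2 * a < n"
      "rev xs = xs"
      using assms by (auto simp: reflection_fixed_def polygon_lists_def compositions_def)
    define y zs where "y = xs ! h" and "zs = take h xs"
    have eq: "xs = zs @ [y] @ rev zs"
      using rev_fixed_odd[OF xs(1)] xs(5) by (simp add: y_def zs_def)
    have n: "n = y + 2 * sum_list zs" using xs(3) eq by simp
    have y: "0 < y" "2 * y < n" using xs eq by auto
    then show "take h xs @ [n - 2 * sum_list (take h xs)] @ rev (take h xs) = xs"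
      using eq n unfolding zs_def[symmetric] by simp
    show "take h xs \<in> pos_lists h ((n - 1) div 2)"
      using xs n y unfolding zs_def[symmetric] pos_lists_def
      by (auto simp: zs_def dest: in_set_takeD)
    show "False" if "take h xs \<in> pos_lists h (n div 4)"
      using that n y unfolding zs_def[symmetric] pos_lists_def by auto
  qed
  then have "card (reflection_fixed m n 0) = card (pos_lists h ((n - 1) div 2) - pos_lists h (n div 4))"
    by (simp add: bij_betw_same_card)
  moreover have "pos_lists h (n div 4) \<subseteq> pos_lists h ((n - 1) div 2)"
    using assms by (auto simp: pos_lists_def)
  ultimately show ?thesis
    using card_mono[OF finite_pos_lists, of "pos_lists h (n div 4)" h "(n - 1) div 2"]
    by (simp add: card_Diff_subset finite_pos_lists card_pos_lists)
qed

text \<open>The first half is a composition of \<open>n / 2\<close>; having at least two parts, it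
  has all of them below \<open>n / 2\<close>.\<close>

lemma card_palindromes_even:
  assumes "m = 2 * h" "h \<ge> 2" "0 < n"
  shows "card (reflection_fixed m n 0) = (if even n then (n div 2 - 1) choose (h - 1) else 0)"
proof -
  have "bij_betw (\<lambda>zs. zs @ rev zs) {zs \<in> compositions h (n div 2). even n} (reflection_fixed m n 0)"
  proof (rule bij_betw_byWitness[where f' = "take h"], safe)
    fix zs assume zs: "zs \<in> compositions h (n div 2)" "even n"
    then show "take h (zs @ rev zs) = zs" by (simp add: compositions_def)
    have "a < sum_list zs" if "a \<in> set zs" for a
      using that zs assms by (intro member_less_sum_list) (auto simp: compositions_def)
    then have "2 * a < n" if "a \<in> set zs" for a
      using that zs by (fastforce simp: compositions_def)
    then show "zs @ rev zs \<in> reflection_fixed m n 0"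
      using zs assms by (auto simp: reflection_fixed_def polygon_lists_def compositions_def)
  next
    fix xs assume "xs \<in> reflection_fixed m n 0"
    then have xs: "length xs = 2 * h" "0 \<notin> set xs" "sum_list xs = n" "rev xs = xs"
      using assms by (auto simp: reflection_fixed_def polygon_lists_def compositions_def)
    define zs where "zs = take h xs"
    have eq: "xs = zs @ rev zs"
      using rev_fixed_even[OF xs(1)] xs(4) by (simp add: zs_def)
    have n: "n = 2 * sum_list zs" using xs(3) eq by simp
    then show "even n" by simp
    show "take h xs @ rev (take h xs) = xs" using eq by (simp add: zs_def)
    show "take h xs \<in> compositions h (n div 2)"
      using xs n unfolding zs_def[symmetric] compositions_def
      by (auto simp: zs_def dest: in_set_takeD)
  qed
  then have "card (reflection_fixed m n 0) = card {zs \<in> compositions h (n div 2). even n}"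
    by (simp add: bij_betw_same_card)
  then show ?thesis using assms card_compositions[of h "n div 2"] by (auto elim!: evenE)
qed

text \<open>A reflection through two entries leaves these in place and pairs up the others. Here
  \<open>x\<close> is one of the two, \<open>zs\<close> holds one entry of each pair, and the second
  fixed entry will be what is missing to \<open>n\<close>.\<close>

definition weighted_lists :: "nat \<Rightarrow> nat \<Rightarrow> (nat \<times> nat list) set" where
  "weighted_lists h N =
     {(x, zs). 0 < x \<and> length zs = h \<and> 0 \<notin> set zs \<and> x + 2 * sum_list zs \<le> N}"

text \<open>Split by the parity of \<open>x\<close>: writing \<open>x\<close> as
  \<open>2 * c\<close> or \<open>2 * c - 1\<close> and halving the inequality bounds
  \<open>c + sum_list zs\<close> by \<open>N div 2\<close> or \<open>(N + 1) div 2\<close>, so that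
  \<open>c # zs\<close> is counted by \<open>card_pos_lists\<close>.\<close>

lemma card_weighted_lists:
  "finite (weighted_lists h N)"
  "card (weighted_lists h N) = ((N div 2) choose Suc h) + (((N + 1) div 2) choose Suc h)"
proof -
  define Ev Od where "Ev = (\<lambda>xs. (2 * hd xs, tl xs)) ` pos_lists (Suc h) (N div 2)"
    and "Od = (\<lambda>xs. (2 * hd xs - 1, tl xs)) ` pos_lists (Suc h) ((N + 1) div 2)"
  have split: "weighted_lists h N = Ev \<union> Od"
  proof (intro equalityI subsetI)
    fix p assume "p \<in> weighted_lists h N"
    then obtain x zs where p: "p = (x, zs)" "0 < x" "length zs = h" "0 \<notin> set zs" "x + 2 * sum_list zs \<le> N"
      by (auto simp: weighted_lists_def)
    show "p \<in> Ev \<union> Od"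
    proof (cases "even x")
      case True
      then obtain c where "x = 2 * c" by (auto elim: evenE)
      then have "c # zs \<in> pos_lists (Suc h) (N div 2)" "p = (2 * hd (c # zs), tl (c # zs))"
        using p by (auto simp: pos_lists_def)
      then show ?thesis unfolding Ev_def by blast
    next
      case False
      then obtain c where "x = 2 * c + 1" by (auto elim: oddE)
      then have "Suc c # zs \<in> pos_lists (Suc h) ((N + 1) div 2)"
        "p = (2 * hd (Suc c # zs) - 1, tl (Suc c # zs))"
        using p by (auto simp: pos_lists_def)
      then show ?thesis unfolding Od_def by blast
    qed
  next
    fix p assume "p \<in> Ev \<union> Od"
    then show "p \<in> weighted_lists h N"
      by (auto simp: Ev_def Od_def weighted_lists_def pos_lists_def length_Suc_conv)
  qed
  have fin: "finite Ev" "finite Od" by (auto simp: Ev_def Od_def finite_pos_lists)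
  then show "finite (weighted_lists h N)" by (simp add: split)
  have "even (fst p)" if "p \<in> Ev" for p using that by (auto simp: Ev_def)
  moreover have "odd (fst p)" if "p \<in> Od" for p
    using that by (auto simp: Od_def pos_lists_def length_Suc_conv)
  ultimately have disj: "Ev \<inter> Od = {}" by blast
  have inj: "inj_on (\<lambda>xs. (f (hd xs), tl xs)) (pos_lists (Suc h) M)"
    if f: "inj_on f {0<..}" for f :: "nat \<Rightarrow> nat" and M
  proof (rule inj_onI)
    fix xs ys assume xs: "xs \<in> pos_lists (Suc h) M" and ys: "ys \<in> pos_lists (Suc h) M"
      and eq: "(f (hd xs), tl xs) = (f (hd ys), tl ys)"
    obtain a us where "xs = a # us" "a > 0" using xs by (cases xs) (auto simp: pos_lists_def)
    moreover obtain b vs where "ys = b # vs" "b > 0" using ys by (cases ys) (auto simp: pos_lists_def)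
    ultimately show "xs = ys" using eq inj_onD[OF f, of a b] by simp
  qed
  have "card Ev = (N div 2) choose Suc h"
    unfolding Ev_def by (subst card_image[OF inj]) (auto simp: inj_on_def card_pos_lists)
  moreover have "card Od = ((N + 1) div 2) choose Suc h"
    unfolding Od_def by (subst card_image[OF inj]) (auto simp: inj_on_def card_pos_lists)
  ultimately show "card (weighted_lists h N) = ((N div 2) choose Suc h) + (((N + 1) div 2) choose Suc h)"
    using fin disj by (simp add: split card_Un_disjoint)
qed

text \<open>This reflection keeps the last entry in place and reverses the others, which thus form a
  palindrome of odd length with middle entry \<open>y\<close>.\<close>

lemma rotate1_rev_fixed:
  assumes "length xs = 2 * h + 2"
  shows "rotate1 (rev xs) = xs \<longleftrightarrow>
    (\<exists>x y zs. length zs = h \<and> xs = zs @ [y] @ rev zs @ [x])"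
proof
  assume p: "rotate1 (rev xs) = xs"
  obtain ys x where xs: "xs = ys @ [x]" using assms by (cases xs rule: rev_exhaust) auto
  have "rev ys = ys" using p xs by simp
  moreover have "length ys = 2 * h + 1" using assms xs by simp
  ultimately have "ys = take h ys @ [ys ! h] @ rev (take h ys)" "length (take h ys) = h"
    using rev_fixed_odd by auto
  then show "\<exists>x y zs. length zs = h \<and> xs = zs @ [y] @ rev zs @ [x]"
    using xs by (metis append.assoc)
qed auto

text \<open>\<open>T\<close> ignores the bound on the parts. Paired entries obey it automatically,
  so only \<open>x\<close> or \<open>y\<close> can violate it, and not both, since
  \<open>h > 0\<close> makes \<open>x + y\<close> smaller than \<open>n\<close>.\<close>

lemma card_reflection_fixed_1:
  assumes "m = 2 * h + 2" "h > 0" "0 < n"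
  shows "card (reflection_fixed m n 1) + 2 * card (weighted_lists h (n div 2)) =
    card (weighted_lists h (n - 1))"
proof -
  define T where "T = {(x, y, zs). 0 < x \<and> 0 < y \<and> length zs = h \<and> 0 \<notin> set zs \<and>
    x + y + 2 * sum_list zs = n}"
  define B1 where "B1 = {(x, y, zs) \<in> T. n \<le> 2 * y}"
  define B2 where "B2 = {(x, y, zs) \<in> T. n \<le> 2 * x}"
  define F where "F = {(x, y, zs) \<in> T. 2 * x < n \<and> 2 * y < n}"
  have T: "bij_betw (\<lambda>(x, zs). (x, n - (x + 2 * sum_list zs), zs)) (weighted_lists h (n - 1)) T"
    using assms by (intro bij_betw_byWitness[where f' = "\<lambda>(x, y, zs). (x, zs)"])
      (auto simp: T_def weighted_lists_def)
  then have finT: "finite T" using card_weighted_lists(1) bij_betw_finite by blast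
  \<comment> \<open>The second fixed entry reaches \<open>n / 2\<close> exactly when the rest sums
    to at most \<open>n div 2\<close>.\<close>
  have "bij_betw (\<lambda>(x, zs). (x, n - (x + 2 * sum_list zs), zs)) (weighted_lists h (n div 2)) B1"
    using assms by (intro bij_betw_byWitness[where f' = "\<lambda>(x, y, zs). (x, zs)"])
      (auto simp: T_def B1_def weighted_lists_def)
  then have B1: "card B1 = card (weighted_lists h (n div 2))" by (simp add: bij_betw_same_card)
  have "bij_betw (\<lambda>(y, zs). (n - (y + 2 * sum_list zs), y, zs)) (weighted_lists h (n div 2)) B2"
    using assms by (intro bij_betw_byWitness[where f' = "\<lambda>(x, y, zs). (y, zs)"])
      (auto simp: T_def B2_def weighted_lists_def)
  then have B2: "card B2 = card (weighted_lists h (n div 2))" by (simp add: bij_betw_same_card)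
  have disj: "B1 \<inter> B2 = {}"
  proof -
    have "0 < sum_list zs" if "length zs = h" "0 \<notin> set zs" for zs :: "nat list"
      using that assms by (intro sum_list_pos_if_zero_notin) auto
    then show ?thesis by (fastforce simp: B1_def B2_def T_def)
  qed
  have "T = F \<union> (B1 \<union> B2)" "F \<inter> (B1 \<union> B2) = {}"
    by (auto simp: F_def B1_def B2_def)
  moreover have fin: "finite F" "finite B1" "finite B2"
    using finT by (auto simp: F_def B1_def B2_def intro: finite_subset)
  ultimately have cT: "card T = card F + (card B1 + card B2)"
    using disj by (simp add: card_Un_disjoint)
  have "bij_betw (\<lambda>(x, y, zs). zs @ [y] @ rev zs @ [x]) F (reflection_fixed m n 1)"
  proof (rule bij_betwI')
    fix p q assume "p \<in> F" "q \<in> F"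
    then obtain x y zs x' y' zs' where "p = (x, y, zs)" "q = (x', y', zs')" "length zs = length zs'"
      by (auto simp: F_def T_def)
    then show "((case p of (x, y, zs) \<Rightarrow> zs @ [y] @ rev zs @ [x]) =
      (case q of (x, y, zs) \<Rightarrow> zs @ [y] @ rev zs @ [x])) = (p = q)"
      by auto
  next
    fix p assume "p \<in> F"
    then obtain x y zs where p: "p = (x, y, zs)" "0 < x" "0 < y" "length zs = h" "0 \<notin> set zs"
      "x + y + 2 * sum_list zs = n" "2 * x < n" "2 * y < n" by (auto simp: F_def T_def)
    have "2 * a < n" if "a \<in> set zs" for a
      using member_le_sum_list[OF that] p by linarith
    then show "(case p of (x, y, zs) \<Rightarrow> zs @ [y] @ rev zs @ [x]) \<in> reflection_fixed m n 1"
      using p assms by (auto simp: reflection_fixed_def polygon_lists_def compositions_def)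
  next
    fix xs assume "xs \<in> reflection_fixed m n 1"
    then have xs: "xs \<in> polygon_lists m n" "rotate1 (rev xs) = xs"
      by (auto simp: reflection_fixed_def)
    then obtain x y zs where "length zs = h" "xs = zs @ [y] @ rev zs @ [x]"
      using rotate1_rev_fixed[of xs h] assms by (auto simp: polygon_lists_def compositions_def)
    then have "(x, y, zs) \<in> F" "xs = (case (x, y, zs) of (x, y, zs) \<Rightarrow> zs @ [y] @ rev zs @ [x])"
      using xs(1) by (auto simp: F_def T_def polygon_lists_def compositions_def)
    then show "\<exists>p\<in>F. xs = (case p of (x, y, zs) \<Rightarrow> zs @ [y] @ rev zs @ [x])" by blast
  qed
  then have "card F = card (reflection_fixed m n 1)" by (rule bij_betw_same_card)
  then show ?thesis using cT B1 B2 bij_betw_same_card[OF T] by simp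
qed

lemma sum_card_reflection_fixed:
  assumes m: "3 \<le> m" "m \<le> n"
  shows "(\<Sum>k<m. real (card {xs \<in> polygon_lists m n. rotate k (rev xs) = xs})) =
    real m * (real ((m div 2 + (n - m) div 2) choose (m div 2))
       - real ((n div 4) choose (m div 2))
       - (if even m then real (((n + 2) div 4) choose (m div 2)) else 0))"
proof -
  have "(\<Sum>k<m. real (card {xs \<in> polygon_lists m n. rotate k (rev xs) = xs})) =
    (\<Sum>k<m. real (card (reflection_fixed m n k)))"
    by (simp add: reflection_fixed_def)
  also have "\<dots> = real m * (real ((m div 2 + (n - m) div 2) choose (m div 2))
       - real ((n div 4) choose (m div 2))
       - (if even m then real (((n + 2) div 4) choose (m div 2)) else 0))"
  proof (cases "even m")
    case False
    then obtain h where h: "m = 2 * h + 1" by (auto elim: oddE)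
    \<comment> \<open>For odd \<open>m\<close> the indices \<open>k\<close> and \<open>k + m\<close>
      give the same reflection but have opposite parities, so all reflections are conjugate.\<close>
    have all: "card (reflection_fixed m n k) = card (reflection_fixed m n 0)" for k
    proof (cases "even k")
      case True
      then show ?thesis using card_reflection_fixed_parity[of m n k] m by simp
    next
      case False
      have "reflection_fixed m n k = reflection_fixed m n (k + m)"
        by (rule reflection_fixed_mod) simp
      moreover have "(k + m) mod 2 = 0" using False h by simp
      ultimately show ?thesis using card_reflection_fixed_parity[of m n "k + m"] m by simp
    qed
    have "m div 2 + (n - m) div 2 = (n - 1) div 2" "m div 2 = h" using h m by auto
    moreover have "real (card (reflection_fixed m n 0)) + real ((n div 4) choose h) = real (((n - 1) div 2) choose h)"
      using card_palindromes_odd[of m h n] h m by (simp flip: of_nat_add)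
    moreover have "(\<Sum>k<m. real (card (reflection_fixed m n k))) = (\<Sum>k<m. real (card (reflection_fixed m n 0)))"
      by (intro sum.cong refl arg_cong[of _ _ real] all)
    ultimately show ?thesis using False by simp
  next
    case True
    then obtain h where "m = 2 * h" by (auto elim: evenE)
    then obtain g where h: "m = 2 * h" "h = Suc g" "0 < g" using m by (cases h) auto
    let ?r = "\<lambda>k. real (card (reflection_fixed m n k))"
    \<comment> \<open>For even \<open>m\<close> half of the reflections have even index and half odd
      index.\<close>
    have "(\<Sum>k<2 * j. ?r k) = real j * (?r 0 + ?r 1)" for j
    proof (induction j)
      case (Suc j)
      have "?r (2 * j) = ?r 0" "?r (Suc (2 * j)) = ?r 1"
        using card_reflection_fixed_parity[of m n "2 * j"]
          card_reflection_fixed_parity[of m n "Suc (2 * j)"] m by auto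
      then show ?case using Suc by (simp add: algebra_simps)
    qed simp
    then have "(\<Sum>k<m. ?r k) = real h * (?r 0 + ?r 1)" using h(1) by simp
    moreover have "?r 0 + ?r 1 = 2 * (real ((n div 2) choose h)
       - real ((n div 4) choose h) - real (((n + 2) div 4) choose h))"
    proof -
      have r0: "?r 0 = (if even n then real ((n div 2 - 1) choose g) else 0)"
        using card_palindromes_even[of m h n] h m by simp
      have "card (reflection_fixed m n 1) + 2 * card (weighted_lists g (n div 2)) =
        card (weighted_lists g (n - 1))"
        using h m by (intro card_reflection_fixed_1) auto
      then have "?r 1 + 2 * real (card (weighted_lists g (n div 2))) =
        real (card (weighted_lists g (n - 1)))"
        by (simp flip: of_nat_add of_nat_mult)
      moreover have "card (weighted_lists g (n div 2)) = ((n div 4) choose h) + (((n + 2) div 4) choose h)"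
      proof -
        have "n div 2 div 2 = n div 4" "(n div 2 + 1) div 2 = (n + 2) div 4" by presburger+
        then show ?thesis using card_weighted_lists(2)[of g "n div 2"] h by simp
      qed
      moreover have "card (weighted_lists g (n - 1)) = (((n - 1) div 2) choose h) + ((n div 2) choose h)"
        using card_weighted_lists(2)[of g "n - 1"] h m by simp
      ultimately have r1: "?r 1 = real (((n - 1) div 2) choose h) + real ((n div 2) choose h)
        - 2 * (real ((n div 4) choose h) + real (((n + 2) div 4) choose h))"
        by simp
      \<comment> \<open>For even \<open>n\<close> this is Pascal's rule, as
        \<open>(n - 1) div 2\<close> is \<open>n div 2 - 1\<close>; for odd \<open>n\<close> the two
        halves \<open>(n - 1) div 2\<close> and \<open>n div 2\<close> coincide.\<close>
      have "(if even n then real ((n div 2 - 1) choose g) else 0) + real (((n - 1) div 2) choose h)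
        = real ((n div 2) choose h)"
      proof (cases "even n")
        case True
        then obtain N where "n = 2 * N" by (auto elim: evenE)
        moreover then obtain M where "N = Suc M" using m by (cases N) auto
        ultimately show ?thesis using h by simp
      qed (auto elim!: oddE)
      then show ?thesis using r0 r1 by simp
    qed
    moreover have "m div 2 + (n - m) div 2 = n div 2" "m div 2 = h" using h m by auto
    ultimately show ?thesis using True h(1) by simp
  qed
  finally show ?thesis .
qed

subsection \<open>Integer polygons and integer tuples\<close>

lemma dihedral_eq_map_inj:
  assumes "inj f"
  shows "dihedral_eq (map f xs) (map f ys) \<longleftrightarrow> dihedral_eq xs ys"
proof -
  have "map f ys = rotate k (map f xs) \<longleftrightarrow> ys = rotate k xs"
    "map f ys = rotate k (rev (map f xs)) \<longleftrightarrow> ys = rotate k (rev xs)" for k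
    using assms by (simp_all add: rotate_map rev_map inj_map_eq_map)
  then show ?thesis by (simp add: dihedral_eq_def)
qed

definition nat_side_lengths :: "complex list \<Rightarrow> nat list" where
  "nat_side_lengths P = map (\<lambda>x. nat \<lfloor>x\<rfloor>) (side_lengths P)"

lemma map_real_nat_side_lengths:
  assumes "P \<in> integer_polygons m n"
  shows "map real (nat_side_lengths P) = side_lengths P"
proof -
  have "real (nat \<lfloor>a\<rfloor>) = a" if "a \<in> set (side_lengths P)" for a
  proof -
    have "a \<in> \<int>" "0 < a" using that assms by (auto simp: integer_polygons_def)
    then show ?thesis by (auto elim!: Ints_cases)
  qed
  then show ?thesis by (simp add: nat_side_lengths_def map_idI)
qed

text \<open>One inclusion is the strict polygon inequality, the other the existence of an inscribed
  polygon.\<close>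

lemma nat_side_lengths_image:
  assumes "3 \<le> m"
  shows "nat_side_lengths ` integer_polygons m n = polygon_lists m n"
proof (intro equalityI subsetI)
  fix xs assume "xs \<in> nat_side_lengths ` integer_polygons m n"
  then obtain P where P: "P \<in> integer_polygons m n" "xs = nat_side_lengths P" by auto
  then have eq: "side_lengths P = map real xs" using map_real_nat_side_lengths by simp
  have len: "length P = m" using P by (simp add: integer_polygons_def is_polygon_def)
  have "real (sum_list xs) = real n"
    using P(1) eq by (simp add: integer_polygons_def perimeter_def sum_list_of_nat)
  moreover have "2 * a < n \<and> a \<noteq> 0" if "a \<in> set xs" for a
  proof -
    have a: "real a \<in> set (side_lengths P)" using that eq by simp
    then have "2 * real a < perimeter P" "0 < real a"
      using P(1) polygon_inequality[of m P "real a"] by (auto simp: integer_polygons_def)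
    then show ?thesis using P(1) by (simp add: integer_polygons_def)
  qed
  moreover have "length xs = m" using len P(2) by (simp add: nat_side_lengths_def)
  ultimately show "xs \<in> polygon_lists m n" by (auto simp: polygon_lists_def compositions_def)
next
  fix xs assume xs: "xs \<in> polygon_lists m n"
  have sum: "sum_list (map real xs) = real n"
    using xs by (simp add: polygon_lists_def compositions_def sum_list_of_nat)
  have "\<exists>P. is_polygon m P \<and> side_lengths P = map real xs"
  proof (rule polygon_with_side_lengths_exists)
    fix a assume "a \<in> set (map real xs)"
    then obtain b where "a = real b" "b \<in> set xs" by auto
    then show "0 < a" "2 * a < sum_list (map real xs)"
      using xs unfolding sum by (auto simp: polygon_lists_def compositions_def intro: Nat.gr0I)
  qed (use xs assms in \<open>auto simp: polygon_lists_def compositions_def\<close>)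
  then obtain P where P: "is_polygon m P" "side_lengths P = map real xs" by auto
  have "P \<in> integer_polygons m n"
    using P xs sum by (auto simp: integer_polygons_def perimeter_def polygon_lists_def compositions_def
        intro: Nat.gr0I)
  moreover have "nat_side_lengths P = xs" using P(2) by (simp add: nat_side_lengths_def o_def)
  ultimately show "xs \<in> nat_side_lengths ` integer_polygons m n" by auto
qed

text \<open>\<open>polygon_equiv\<close> is the pullback of the dihedral relation along the
  surjection \<open>nat_side_lengths\<close>.\<close>

lemma num_polygons_eq_card_classes:
  assumes "3 \<le> m"
  shows "num_polygons m n = card (polygon_lists m n //
    {(xs, ys). xs \<in> polygon_lists m n \<and> ys \<in> polygon_lists m n \<and> dihedral_eq xs ys})"
    (is "_ = card (_ // ?R)")
proof -
  have "dihedral_eq (side_lengths P) (side_lengths Q) \<longleftrightarrow> (nat_side_lengths P, nat_side_lengths Q) \<in> ?R"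
    if "P \<in> integer_polygons m n" "Q \<in> integer_polygons m n" for P Q
  proof -
    have "nat_side_lengths P \<in> polygon_lists m n" "nat_side_lengths Q \<in> polygon_lists m n"
      using that nat_side_lengths_image[OF assms] by blast+
    moreover have "dihedral_eq (side_lengths P) (side_lengths Q) \<longleftrightarrow>
      dihedral_eq (nat_side_lengths P) (nat_side_lengths Q)"
      using dihedral_eq_map_inj[OF inj_of_nat] map_real_nat_side_lengths that by metis
    ultimately show ?thesis by simp
  qed
  then have "polygon_equiv m n = {(P, Q). P \<in> integer_polygons m n \<and> Q \<in> integer_polygons m n \<and>
    (nat_side_lengths P, nat_side_lengths Q) \<in> ?R}"
    unfolding polygon_equiv_def by blast
  moreover have "equiv (polygon_lists m n) ?R"
  proof (rule card_dihedral_classes(1))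
    show "length xs = m" if "xs \<in> polygon_lists m n" for xs
      using that by (simp add: polygon_lists_def compositions_def)
  qed (use assms in \<open>auto intro: finite_polygon_lists rotate_in_polygon_lists rev_in_polygon_lists\<close>)
  ultimately show ?thesis
    unfolding num_polygons_def
    using card_quotient_surj[OF nat_side_lengths_image[OF assms], where R = ?R] by (simp only:)
qed

section \<open>Assembling the count\<close>

theorem theorem1p5:
  fixes m n :: nat
  assumes "3 \<le> m" and "m \<le> n"
  shows "real (num_polygons m n) =
    (\<Sum>d | d dvd gcd m n.
       real (totient d) / (2 * real n) * real ((n div d) choose (m div d)))
    + 1 / 2 *
      (real ((m div 2 + (n - m) div 2) choose (m div 2))
       - real ((n div 2) choose (m - 1))
       - real ((n div 4) choose (m div 2))
       - (if even m then real (((n + 2) div 4) choose (m div 2)) else 0))"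
proof -
  let ?T = "polygon_lists m n"
  have "2 * m * num_polygons m n =
    (\<Sum>k<m. card {xs \<in> ?T. rotate k xs = xs}) + (\<Sum>k<m. card {xs \<in> ?T. rotate k (rev xs) = xs})"
    unfolding num_polygons_eq_card_classes[OF assms(1)]
  proof (rule card_dihedral_classes(2))
    show "length xs = m" if "xs \<in> ?T" for xs
      using that by (simp add: polygon_lists_def compositions_def)
  qed (use assms in \<open>auto intro: finite_polygon_lists rotate_in_polygon_lists rev_in_polygon_lists\<close>)
  then have "real (2 * m * num_polygons m n) =
    (\<Sum>k<m. real (card {xs \<in> ?T. rotate k xs = xs})) +
    (\<Sum>k<m. real (card {xs \<in> ?T. rotate k (rev xs) = xs}))"
    by (simp only: of_nat_add of_nat_sum)
  then have "2 * real m * real (num_polygons m n) =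
    (\<Sum>d | d dvd gcd m n. real (totient d) * (real m / real n) * real ((n div d) choose (m div d)))
    - real m * real ((n div 2) choose (m - 1))
    + real m * (real ((m div 2 + (n - m) div 2) choose (m div 2))
       - real ((n div 4) choose (m div 2))
       - (if even m then real (((n + 2) div 4) choose (m div 2)) else 0))"
    unfolding sum_card_rotation_fixed[OF assms] sum_card_reflection_fixed[OF assms] by simp
  also have "(\<Sum>d | d dvd gcd m n. real (totient d) * (real m / real n) * real ((n div d) choose (m div d)))
    = 2 * real m * (\<Sum>d | d dvd gcd m n.
       real (totient d) / (2 * real n) * real ((n div d) choose (m div d)))"
    unfolding sum_distrib_left by (intro sum.cong) auto
  finally have total: "2 * real m * real (num_polygons m n) =
    2 * real m * (\<Sum>d | d dvd gcd m n.
       real (totient d) / (2 * real n) * real ((n div d) choose (m div d)))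
    - real m * real ((n div 2) choose (m - 1))
    + real m * (real ((m div 2 + (n - m) div 2) choose (m div 2))
       - real ((n div 4) choose (m div 2))
       - (if even m then real (((n + 2) div 4) choose (m div 2)) else 0))" .
  \<comment> \<open>Division of the Burnside total by the group order, with \<open>c\<close>
    standing for \<open>m\<close>.\<close>
  have cancel: "N = S + 1 / 2 * (C - B - D - E)"
    if "2 * c * N = 2 * c * S - c * B + c * (C - D - E)" "c \<noteq> 0" for c N S B C D E :: real
  proof -
    have "c * (2 * N) = c * (2 * S - B + (C - D - E))" using that(1) by (simp add: algebra_simps)
    then have "2 * N = 2 * S - B + (C - D - E)" using that(2) by simp
    then show ?thesis by argo
  qed
  show ?thesis using assms by (intro cancel[OF total]) simp
qed

end
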